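(* Let $D$ be an integral domain and $S$ a multiplicatively closed subset of $D$. Then $D+XD_S[X]$ is an S-domain.
   Context: All rings are commutative with unity. $D_S$ denotes the localization of $D$ at the multiplicatively closed set $S$, where $0\notin S$, so that $D\subset D_S$; $D+XD_S[X]=\{a_0+\sum_{i\ge 1} a_iX^i \mid a_0\in D,\ a_i\in D_S\}$ is a subring of the polynomial ring $D_S[X]$. An integral domain $R$ is called an S-domain if for each prime ideal $P$ of $R$ of height one, the extended prime ideal $P[Y]$ of the polynomial ring $R[Y]$ (polynomials with all coefficients in $P$) also has height one. (The "S" in "S-domain" is unrelated to the set $S$.) *)

theory Defs
  imports
    "HOL-Algebra.UnivPoly"
    "HOL-Algebra.Algebraic_Closure_Type"
    "HOL-Computational_Algebra.Fraction_Field"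
    "HOL-Library.Extended_Nat"
begin

text \<open>
  The supremum of the lengths \<open>n\<close> of the strict chains of prime ideals
  \<open>C 0 \<subset> C 1 \<subset> \<dots> \<subset> C n = P\<close>. It is only meaningful for prime \<open>P\<close>: for other
  sets there is no such chain and the value is \<open>0\<close>.
\<close>
definition prime_height :: "('a, 'm) ring_scheme \<Rightarrow> 'a set \<Rightarrow> enat" where
  "prime_height R P =
     (SUP n \<in> {n :: nat. \<exists>C :: nat \<Rightarrow> 'a set.
                 (\<forall>i\<le>n. primeideal (C i) R) \<and> (\<forall>i<n. C i \<subset> C (Suc i)) \<and> C n = P}. enat n)"

definition extended_ideal :: "('a, 'm) ring_scheme \<Rightarrow> 'a set \<Rightarrow> (nat \<Rightarrow> 'a) set" where
  "extended_ideal R P = {p \<in> carrier (UP R). \<forall>n. UnivPoly.coeff (UP R) p n \<in> P}"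

definition S_domain :: "('a, 'm) ring_scheme \<Rightarrow> bool" where
  "S_domain R \<longleftrightarrow> domain R \<and>
     (\<forall>P. primeideal P R \<and> prime_height R P = 1 \<longrightarrow>
        prime_height (UP R) (extended_ideal R P) = 1)"

text \<open>
  The integral domain \<open>D\<close> is the type \<open>'a\<close>. Its localization at \<open>S\<close> is taken inside the
  fraction field, which is legitimate because \<open>0 \<notin> S\<close>; there \<open>D\<close> itself is the set of
  all \<open>Fract a 1\<close>, and it is contained in the localization as \<open>a = a s / s\<close>.
\<close>
definition localization :: "'a::idom set \<Rightarrow> 'a fract set" where
  "localization S = {Fract a s | a s. s \<in> S}"

definition D_plus_X_loc :: "'a::idom set \<Rightarrow> 'a fract poly ring" where
  "D_plus_X_loc S = ring_of_type_algebra
     \<lparr>carrier := {f. Polynomial.coeff f 0 \<in> range (\<lambda>a. Fract a 1) \<and>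
                      (\<forall>i\<ge>1. Polynomial.coeff f i \<in> localization S)}\<rparr>"

end

theory Submission
  imports Defs
begin

text \<open>
  Write \<open>R = D + X D\<^sub>S[X]\<close>, let \<open>K\<close> be the fraction field of \<open>D\<close>, and let \<open>N\<close> be a nonzero prime of
  \<open>R[Y]\<close> strictly below \<open>P[Y]\<close>, where \<open>P\<close> has height one. Then \<open>N \<inter> R = 0\<close>.
  If \<open>P \<inter> D = 0\<close>, then \<open>P\<close> becomes principal in \<open>K[X]\<close>, and dividing by its generator gives an
  infinite descent in \<open>N\<close>. Otherwise let \<open>q = P \<inter> D\<close>. It misses \<open>S\<close>, since an \<open>s \<in> S \<inter> P\<close> would
  put the prime \<open>X D\<^sub>S[X]\<close> strictly between \<open>0\<close> and \<open>P\<close>; hence \<open>P = q D\<^sub>S[X] \<inter> R\<close>, and height one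
  means that every \<open>t \<in> K\<close> is a root of a polynomial over \<open>D\<close> whose coefficients are not all in \<open>q\<close>.
  Consequently any valuation ring of \<open>K\<close> above \<open>q\<close> is residually algebraic over \<open>D / q\<close>. Choose one, with
  prime \<open>p\<close>, that is dominated by a place of \<open>K[X,Y] / N K[X,Y]\<close> above \<open>q[X,Y]\<close>. A nonzero element of
  \<open>N\<close>, divided by its coefficient of least value, is nonzero and algebraic over \<open>D[X,Y]\<close> modulo \<open>p[X,Y]\<close>,
  so a multiple of it is congruent to an element of \<open>D[X,Y]\<close> outside \<open>q[X,Y]\<close>; but that element
  would vanish at the place.
\<close>

subsection \<open>Subrings and prime ideals as sets\<close>

text \<open>Subrings, ideals and primes are subsets of one ambient type, so that the inclusions
  among \<open>D\<close>, its overrings in \<open>K\<close> and the polynomial rings over them are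
  literal.\<close>

definition is_subring :: "'t::comm_ring_1 set \<Rightarrow> bool" where
  "is_subring C \<longleftrightarrow> 1 \<in> C \<and> (\<forall>x\<in>C. \<forall>y\<in>C. x - y \<in> C \<and> x * y \<in> C)"

definition is_ideal :: "'t::comm_ring_1 set \<Rightarrow> 't set \<Rightarrow> bool" where
  "is_ideal C J \<longleftrightarrow> J \<subseteq> C \<and> 0 \<in> J \<and> (\<forall>x\<in>J. \<forall>y\<in>J. x + y \<in> J) \<and> (\<forall>c\<in>C. \<forall>x\<in>J. c * x \<in> J)"

definition is_prime :: "'t::comm_ring_1 set \<Rightarrow> 't set \<Rightarrow> bool" where
  "is_prime C J \<longleftrightarrow> is_ideal C J \<and> 1 \<notin> J \<and> (\<forall>x\<in>C. \<forall>y\<in>C. x * y \<in> J \<longrightarrow> x \<in> J \<or> y \<in> J)"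

context
  fixes C :: "'t::comm_ring_1 set"
  assumes C: "is_subring C"
begin

lemma subring_one: "1 \<in> C"
  and subring_diff: "x \<in> C \<Longrightarrow> y \<in> C \<Longrightarrow> x - y \<in> C"
  and subring_mult: "x \<in> C \<Longrightarrow> y \<in> C \<Longrightarrow> x * y \<in> C"
  using C by (auto simp: is_subring_def)

lemma subring_zero: "0 \<in> C"
  using subring_diff[OF subring_one subring_one] by simp

lemma subring_uminus: "x \<in> C \<Longrightarrow> - x \<in> C"
  using subring_diff[OF subring_zero] by fastforce

lemma subring_add: "x \<in> C \<Longrightarrow> y \<in> C \<Longrightarrow> x + y \<in> C"
  using subring_diff[of x "- y"] subring_uminus by simp

lemma subring_sum: "(\<And>i. i \<in> A \<Longrightarrow> f i \<in> C) \<Longrightarrow> sum f A \<in> C"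
  by (induction A rule: infinite_finite_induct) (auto intro: subring_zero subring_add)

lemma subring_power: "x \<in> C \<Longrightarrow> x ^ n \<in> C"
  by (induction n) (auto intro: subring_one subring_mult)

lemma subring_of_nat: "of_nat n \<in> C"
  by (induction n) (auto intro: subring_zero subring_one subring_add)

lemmas subring_closed = subring_one subring_diff subring_mult subring_zero subring_uminus
  subring_add subring_sum subring_power subring_of_nat

context
  fixes J :: "'t set"
  assumes J: "is_ideal C J"
begin

lemma ideal_mem: "x \<in> J \<Longrightarrow> x \<in> C"
  and ideal_zero: "0 \<in> J"
  and ideal_add: "x \<in> J \<Longrightarrow> y \<in> J \<Longrightarrow> x + y \<in> J"
  and ideal_mult: "c \<in> C \<Longrightarrow> x \<in> J \<Longrightarrow> c * x \<in> J"
  using J by (auto simp: is_ideal_def)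

lemma ideal_mult2: "c \<in> C \<Longrightarrow> x \<in> J \<Longrightarrow> x * c \<in> J"
  using ideal_mult by (simp add: mult.commute)

lemma ideal_uminus: "x \<in> J \<Longrightarrow> - x \<in> J"
  using ideal_mult[OF subring_uminus[OF subring_one]] by fastforce

lemma ideal_diff: "x \<in> J \<Longrightarrow> y \<in> J \<Longrightarrow> x - y \<in> J"
  using ideal_add[of x "- y"] ideal_uminus by simp

lemma ideal_sum: "(\<And>i. i \<in> A \<Longrightarrow> f i \<in> J) \<Longrightarrow> sum f A \<in> J"
  by (induction A rule: infinite_finite_induct) (auto intro: ideal_zero ideal_add)

lemmas ideal_closed = ideal_zero ideal_add ideal_mult ideal_mult2 ideal_uminus ideal_diff ideal_sum

end

end

lemma is_prime_ideal: "is_prime C J \<Longrightarrow> is_ideal C J"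
  by (simp add: is_prime_def)

subsection \<open>Elements that are algebraic modulo a prime ideal\<close>

text \<open>Congruence modulo \<open>J\<close> stands in for the domain \<open>C / J\<close> over
  its subring \<open>L / (J \<inter> L)\<close>; neither quotients nor their fraction fields are
  formed.\<close>

locale prime_over =
  fixes L C J :: "'t::comm_ring_1 set"
  assumes L: "is_subring L" and C: "is_subring C" and LC: "L \<subseteq> C" and J: "is_prime C J"
begin

lemmas CI = subring_closed[OF C]
lemmas LI = subring_closed[OF L]
lemmas J_zero = ideal_zero[OF C is_prime_ideal[OF J]]
lemmas J_add = ideal_add[OF C is_prime_ideal[OF J]]
lemmas J_mult = ideal_mult[OF C is_prime_ideal[OF J]]
lemmas J_mult2 = ideal_mult2[OF C is_prime_ideal[OF J]]
lemmas J_diff = ideal_diff[OF C is_prime_ideal[OF J]]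
lemmas J_sum = ideal_sum[OF C is_prime_ideal[OF J]]

lemma inC: "x \<in> L \<Longrightarrow> x \<in> C" using LC by auto

lemma one_notin_J: "1 \<notin> J"
  using J by (auto simp: is_prime_def)

lemma prime_mult: "x \<in> C \<Longrightarrow> y \<in> C \<Longrightarrow> x * y \<in> J \<Longrightarrow> x \<in> J \<or> y \<in> J"
  using J by (auto simp: is_prime_def)

text \<open>Gaussian elimination without division, over the domain \<open>L / (J \<inter> L)\<close>.\<close>
lemma linear_dependence:
  assumes "finite B" "finite R" "card B < card R" "\<And>i b. i \<in> R \<Longrightarrow> b \<in> B \<Longrightarrow> m i b \<in> L"
  shows "\<exists>h. (\<forall>i. h i \<in> L) \<and> (\<exists>i\<in>R. h i \<notin> J) \<and> (\<forall>b\<in>B. (\<Sum>i\<in>R. h i * m i b) \<in> J)"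
  using assms
proof (induction B arbitrary: R m rule: finite_induct)
  case empty
  then have "R \<noteq> {}" by auto
  then show ?case using LI(1) one_notin_J by (intro exI[of _ "\<lambda>_. 1"]) auto
next
  case (insert c B)
  show ?case
  proof (cases "\<forall>i\<in>R. m i c \<in> J")
    case True
    obtain h where h: "\<forall>i. h i \<in> L" "\<exists>i\<in>R. h i \<notin> J" "\<forall>b\<in>B. (\<Sum>i\<in>R. h i * m i b) \<in> J"
      using insert.IH[of R m] insert.prems insert.hyps by auto
    have "(\<Sum>i\<in>R. h i * m i c) \<in> J"
      using True h(1) by (auto intro!: J_sum J_mult inC)
    then show ?thesis using h by auto
  next
    case False
    then obtain r where r: "r \<in> R" "m r c \<notin> J" by auto
    define R' where "R' = R - {r}"
    \<comment> \<open>The pivot \<open>m r c\<close> clears column \<open>c\<close> from the other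
      rows.\<close>
    define m' where "m' = (\<lambda>i b. m r c * m i b - m i c * m r b)"
    have mL: "m i b \<in> L" if "i \<in> R" "b \<in> insert c B" for i b using insert.prems that by auto
    have fin: "finite R'" "R = insert r R'" "r \<notin> R'" using insert.prems r R'_def by auto
    have "card B < card R'" using insert.prems insert.hyps fin by simp
    moreover have "m' i b \<in> L" if "i \<in> R'" "b \<in> B" for i b
      unfolding m'_def using that r fin by (intro LI mL) auto
    ultimately obtain h where h: "\<forall>i. h i \<in> L" "\<exists>i\<in>R'. h i \<notin> J"
        "\<forall>b\<in>B. (\<Sum>i\<in>R'. h i * m' i b) \<in> J"
      using insert.IH[of R' m'] fin by blast
    \<comment> \<open>The coefficient of the pivot row makes column \<open>c\<close> cancel exactly;
      the other coefficients absorb the factor \<open>m r c\<close> from the elimination.\<close>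
    define g where "g = (\<lambda>i. if i = r then - (\<Sum>i\<in>R'. h i * m i c) else m r c * h i)"
    have gL: "g i \<in> L" for i
      unfolding g_def using h(1) r fin by (auto intro!: LI mL)
    have key: "(\<Sum>i\<in>R. g i * m i b) = (\<Sum>i\<in>R'. h i * (m r c * m i b - m i c * m r b))" for b
    proof -
      have "(\<Sum>i\<in>R. g i * m i b) = g r * m r b + (\<Sum>i\<in>R'. g i * m i b)"
        using fin by simp
      also have "(\<Sum>i\<in>R'. g i * m i b) = (\<Sum>i\<in>R'. m r c * h i * m i b)"
        using fin(3) by (intro sum.cong) (auto simp: g_def)
      finally have "(\<Sum>i\<in>R. g i * m i b) =
          (\<Sum>i\<in>R'. m r c * h i * m i b) - (\<Sum>i\<in>R'. h i * m i c * m r b)"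
        by (simp add: g_def sum_distrib_right)
      then show ?thesis
        by (simp only: sum_subtractf[symmetric]) (simp add: right_diff_distrib mult_ac)
    qed
    have "\<forall>b\<in>insert c B. (\<Sum>i\<in>R. g i * m i b) \<in> J"
    proof
      fix b assume "b \<in> insert c B"
      show "(\<Sum>i\<in>R. g i * m i b) \<in> J"
      proof (cases "b = c")
        case True
        then show ?thesis unfolding key using J_zero by (simp add: mult.commute)
      next
        case False
        then show ?thesis unfolding key using h(3) \<open>b \<in> insert c B\<close> by (auto simp: m'_def)
      qed
    qed
    moreover obtain i where "i \<in> R'" "h i \<notin> J" using h(2) by auto
    then have "g i \<notin> J"
      using prime_mult[of "m r c" "h i"] r h(1) mL[of r c] fin by (auto simp: g_def inC)
    then have "\<exists>i\<in>R. g i \<notin> J" using \<open>i \<in> R'\<close> fin by auto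
    ultimately show ?thesis using gL by blast
  qed
qed

text \<open>The class of \<open>x\<close> in \<open>C / J\<close> is algebraic over the fraction
  field of \<open>L / (J \<inter> L)\<close>.\<close>

definition alg :: "'t \<Rightarrow> bool" where
  "alg x \<longleftrightarrow> x \<in> C \<and> (\<exists>n h. (\<forall>i. h i \<in> L) \<and> (\<exists>i\<le>n. h i \<notin> J) \<and> (\<Sum>i\<le>n. h i * x ^ i) \<in> J)"

text \<open>The linear span of \<open>B\<close> over that same fraction field, with \<open>s\<close>
  as common denominator.\<close>

definition span_mod :: "'t set \<Rightarrow> 't set" where
  "span_mod B = {e \<in> C. \<exists>s m. s \<in> L \<and> s \<notin> J \<and> (\<forall>b. m b \<in> L) \<and> s * e - (\<Sum>b\<in>B. m b * b) \<in> J}"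

lemma algI:
  assumes "x \<in> C" "\<forall>i. h i \<in> L" "\<exists>i\<le>n. h i \<notin> J" "(\<Sum>i\<le>n. h i * x ^ i) \<in> J"
  shows "alg x"
  using assms unfolding alg_def by auto

lemma algE:
  assumes "alg x"
  obtains n s g where "s \<in> L" "s \<notin> J" "\<And>i. g i \<in> L" "s * x ^ n - (\<Sum>i<n. g i * x ^ i) \<in> J"
proof -
  obtain n h where h: "x \<in> C" "\<forall>i. h i \<in> L" "\<exists>i\<le>n. h i \<notin> J" "(\<Sum>i\<le>n. h i * x ^ i) \<in> J"
    using assms by (auto simp: alg_def)
  define d where "d = Max {i. i \<le> n \<and> h i \<notin> J}"
  have "finite {i. i \<le> n \<and> h i \<notin> J}" by simp
  then have d: "d \<le> n" "h d \<notin> J" "\<And>i. i \<le> n \<Longrightarrow> d < i \<Longrightarrow> h i \<in> J"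
    using Max_in[of "{i. i \<le> n \<and> h i \<notin> J}"] Max_ge[of "{i. i \<le> n \<and> h i \<notin> J}"] h(3)
    unfolding d_def[symmetric] by (auto simp: not_le[symmetric])
  have "{..n} = {..<d} \<union> {d} \<union> {d<..n}" using d by auto
  then have "(\<Sum>i\<le>n. h i * x ^ i) = (\<Sum>i\<in>{..<d} \<union> {d} \<union> {d<..n}. h i * x ^ i)" by simp
  also have "\<dots> = (\<Sum>i<d. h i * x ^ i) + h d * x ^ d + (\<Sum>i\<in>{d<..n}. h i * x ^ i)"
    by (subst sum.union_disjoint; (subst sum.union_disjoint)?) auto
  finally have eq: "h d * x ^ d - (\<Sum>i<d. (- h i) * x ^ i)
      = (\<Sum>i\<le>n. h i * x ^ i) - (\<Sum>i\<in>{d<..n}. h i * x ^ i)"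
    by (simp add: sum_negf)
  have "h d * x ^ d - (\<Sum>i<d. (- h i) * x ^ i) \<in> J"
    unfolding eq using d h by (auto intro!: J_diff J_sum J_mult2 CI)
  then show ?thesis using that[of "h d" "\<lambda>i. - h i" d] d h by (auto intro: LI)
qed

section \<open>Finite spans modulo \<open>J\<close>\<close>

context
  fixes B :: "'t set"
  assumes B: "finite B" "B \<subseteq> C"
begin

lemma span_base: "b \<in> B \<Longrightarrow> b \<in> span_mod B"
proof -
  assume b: "b \<in> B"
  have "1 * b - (\<Sum>c\<in>B. (if c = b then 1 else 0) * c) = 0"
    using b B by (simp add: if_distrib[of "\<lambda>x. x * _"] cong: if_cong)
  then show "b \<in> span_mod B"
    unfolding span_mod_def using b B LI one_notin_J J_zero
    by (auto intro!: exI[of _ 1] exI[of _ "\<lambda>c. if c = b then 1 else 0"])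
qed

lemma span_add:
  assumes "x \<in> span_mod B" "y \<in> span_mod B"
  shows "x + y \<in> span_mod B"
proof -
  obtain s m where 1: "x \<in> C" "s \<in> L" "s \<notin> J" "\<forall>b. m b \<in> L" "s * x - (\<Sum>b\<in>B. m b * b) \<in> J"
    using assms by (auto simp: span_mod_def)
  obtain t l where 2: "y \<in> C" "t \<in> L" "t \<notin> J" "\<forall>b. l b \<in> L" "t * y - (\<Sum>b\<in>B. l b * b) \<in> J"
    using assms by (auto simp: span_mod_def)
  have "(s * t) * (x + y) - (\<Sum>b\<in>B. (t * m b + s * l b) * b) =
      t * (s * x - (\<Sum>b\<in>B. m b * b)) + s * (t * y - (\<Sum>b\<in>B. l b * b))"
    by (simp add: algebra_simps sum.distrib sum_distrib_left)
  also have "\<dots> \<in> J" using 1 2 by (auto intro!: J_add J_mult inC)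
  finally have "(s * t) * (x + y) - (\<Sum>b\<in>B. (t * m b + s * l b) * b) \<in> J" .
  moreover have "s * t \<notin> J" using 1 2 prime_mult inC by blast
  ultimately show ?thesis
    unfolding span_mod_def using 1 2
    by (auto intro!: exI[of _ "s * t"] exI[of _ "\<lambda>b. t * m b + s * l b"] LI CI)
qed

lemma span_smult:
  assumes "c \<in> L" "x \<in> span_mod B"
  shows "c * x \<in> span_mod B"
proof -
  obtain s m where 1: "x \<in> C" "s \<in> L" "s \<notin> J" "\<forall>b. m b \<in> L" "s * x - (\<Sum>b\<in>B. m b * b) \<in> J"
    using assms by (auto simp: span_mod_def)
  have "s * (c * x) - (\<Sum>b\<in>B. (c * m b) * b) = c * (s * x - (\<Sum>b\<in>B. m b * b))"
    by (simp add: algebra_simps sum_distrib_left)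
  also have "\<dots> \<in> J" using 1 assms by (auto intro!: J_add J_mult inC)
  finally have "s * (c * x) - (\<Sum>b\<in>B. (c * m b) * b) \<in> J" .
  moreover have "c * x \<in> C" "\<forall>b. c * m b \<in> L"
    using 1 assms by (auto intro: CI LI inC)
  ultimately show ?thesis
    unfolding span_mod_def using 1 by (auto intro!: exI[of _ s] exI[of _ "\<lambda>b. c * m b"])
qed

lemma span_zero: "0 \<in> span_mod B"
  unfolding span_mod_def using LI one_notin_J J_zero CI(4)
  by (auto intro!: exI[of _ 1] exI[of _ "\<lambda>_. 0"])

lemma span_sum: "(\<And>i. i \<in> A \<Longrightarrow> f i \<in> span_mod B) \<Longrightarrow> sum f A \<in> span_mod B"
  by (induction A rule: infinite_finite_induct) (auto intro: span_zero span_add)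

lemma span_divide:
  assumes "s \<in> L" "s \<notin> J" "x \<in> C" "y \<in> span_mod B" "s * x - y \<in> J"
  shows "x \<in> span_mod B"
proof -
  obtain t m where 1: "y \<in> C" "t \<in> L" "t \<notin> J" "\<forall>b. m b \<in> L" "t * y - (\<Sum>b\<in>B. m b * b) \<in> J"
    using assms by (auto simp: span_mod_def)
  have "(s * t) * x - (\<Sum>b\<in>B. m b * b) = t * (s * x - y) + (t * y - (\<Sum>b\<in>B. m b * b))"
    by (simp add: algebra_simps)
  also have "\<dots> \<in> J" using 1 assms by (auto intro!: J_add J_mult inC)
  finally have "(s * t) * x - (\<Sum>b\<in>B. m b * b) \<in> J" .
  moreover have "s * t \<notin> J" using 1 assms prime_mult inC by blast
  ultimately show ?thesis
    unfolding span_mod_def using 1 assms by (auto intro!: exI[of _ "s * t"] exI[of _ m] LI)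
qed

text \<open>The first \<open>card B + 1\<close> powers of \<open>z\<close> are combinations of
  \<open>card B\<close> elements, hence linearly dependent.\<close>

lemma alg_if_powers_in_span:
  assumes z: "z \<in> C" "\<And>k. z ^ k \<in> span_mod B"
  shows "alg z"
proof -
  have "\<forall>k. \<exists>s m. s \<in> L \<and> s \<notin> J \<and> (\<forall>b. m b \<in> L) \<and> s * z ^ k - (\<Sum>b\<in>B. m b * b) \<in> J"
    using z by (auto simp: span_mod_def)
  then obtain s m where sm: "\<And>k. s k \<in> L" "\<And>k. s k \<notin> J" "\<And>k b. m k b \<in> L"
      "\<And>k. s k * z ^ k - (\<Sum>b\<in>B. m k b * b) \<in> J"
    by metis
  obtain h where h: "\<forall>i. h i \<in> L" "\<exists>i\<in>{..card B}. h i \<notin> J"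
      "\<forall>b\<in>B. (\<Sum>i\<in>{..card B}. h i * m i b) \<in> J"
    using linear_dependence[of B "{..card B}" m] B sm by auto
  \<comment> \<open>The dependence \<open>h\<close> kills the parts in \<open>B\<close> modulo
    \<open>J\<close>. What remains is a relation for \<open>z\<close> with coefficients
    \<open>h i * s i\<close>, one of which stays outside \<open>J\<close> by primeness.\<close>
  have "(\<Sum>i\<le>card B. h i * s i * z ^ i) =
     (\<Sum>i\<le>card B. h i * (s i * z ^ i - (\<Sum>b\<in>B. m i b * b))) + (\<Sum>i\<le>card B. \<Sum>b\<in>B. h i * m i b * b)"
    by (simp add: algebra_simps sum_subtractf sum_distrib_left)
  also have "(\<Sum>i\<le>card B. \<Sum>b\<in>B. h i * m i b * b) = (\<Sum>b\<in>B. (\<Sum>i\<le>card B. h i * m i b) * b)"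
    by (subst sum.swap) (simp add: sum_distrib_right)
  also have "(\<Sum>i\<le>card B. h i * (s i * z ^ i - (\<Sum>b\<in>B. m i b * b))) + \<dots> \<in> J"
  proof (rule J_add)
    show "(\<Sum>i\<le>card B. h i * (s i * z ^ i - (\<Sum>b\<in>B. m i b * b))) \<in> J"
      using h(1) sm(4) by (intro J_sum J_mult) (auto intro: inC)
    show "(\<Sum>b\<in>B. (\<Sum>i\<le>card B. h i * m i b) * b) \<in> J"
      using h(3) B by (intro J_sum, intro J_mult2) auto
  qed
  finally have "(\<Sum>i\<le>card B. h i * s i * z ^ i) \<in> J" .
  moreover have "\<exists>i\<le>card B. h i * s i \<notin> J" using h sm prime_mult inC by (meson atMost_iff)
  moreover have "\<forall>i. h i * s i \<in> L" using h sm by (auto intro: LI)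
  ultimately show ?thesis using z(1) by (intro algI[of z "\<lambda>i. h i * s i" "card B"])
qed

end

lemma alg_in_C: "alg x \<Longrightarrow> x \<in> C"
  by (simp add: alg_def)

text \<open>The monomials with exponents below the degrees of the two relations span all others,
  because each relation lowers the exponent of its own variable.\<close>

lemma alg_finite_span:
  assumes "alg x" "alg y"
  obtains B where "finite B" "B \<subseteq> C" "\<And>i j. x ^ i * y ^ j \<in> span_mod B"
proof -
  obtain n s g where x: "s \<in> L" "s \<notin> J" "\<And>i. g i \<in> L" "s * x ^ n - (\<Sum>i<n. g i * x ^ i) \<in> J"
    using assms(1) by (rule algE) blast
  obtain m t h where y: "t \<in> L" "t \<notin> J" "\<And>i. h i \<in> L" "t * y ^ m - (\<Sum>i<m. h i * y ^ i) \<in> J"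
    using assms(2) by (rule algE) blast
  note xy = alg_in_C[OF assms(1)] alg_in_C[OF assms(2)]
  define B where "B = (\<lambda>(i, j). x ^ i * y ^ j) ` ({..<n} \<times> {..<m})"
  have B: "finite B" "B \<subseteq> C"
    using xy by (auto simp: B_def intro!: CI)
  \<comment> \<open>The exponent of \<open>x\<close> is reduced first, while that of
    \<open>y\<close> is still small; the general case then reduces the exponent of \<open>y\<close>
    for any power of \<open>x\<close>.\<close>
  have 1: "x ^ i * y ^ j \<in> span_mod B" if "j < m" for i j
  proof (induction i rule: less_induct)
    case (less i)
    show ?case
    proof (cases "i < n")
      case True
      then show ?thesis using that by (intro span_base[OF B]) (auto simp: B_def)
    next
      case False
      have span: "(\<Sum>k<n. g k * (x ^ (k + (i - n)) * y ^ j)) \<in> span_mod B"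
        using False x(3) by (intro span_sum[OF B] span_smult[OF B] less.IH) auto
      have "s * (x ^ i * y ^ j) - (\<Sum>k<n. g k * (x ^ (k + (i - n)) * y ^ j))
          = (s * x ^ n - (\<Sum>k<n. g k * x ^ k)) * (x ^ (i - n) * y ^ j)"
      proof -
        have "x ^ i = x ^ n * x ^ (i - n)" using False by (simp flip: power_add)
        show ?thesis
          unfolding left_diff_distrib sum_distrib_right power_add \<open>x ^ i = _\<close> by (simp only: mult_ac)
      qed
      moreover have "(s * x ^ n - (\<Sum>k<n. g k * x ^ k)) * (x ^ (i - n) * y ^ j) \<in> J"
        using x(4) xy by (intro J_mult2) (auto intro!: CI)
      ultimately have "s * (x ^ i * y ^ j) - (\<Sum>k<n. g k * (x ^ (k + (i - n)) * y ^ j)) \<in> J"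
        by (simp only:)
      moreover have "x ^ i * y ^ j \<in> C" using xy by (intro CI)
      ultimately show ?thesis
        using span_divide[OF B x(1,2)] span by blast
    qed
  qed
  have 2: "x ^ i * y ^ j \<in> span_mod B" for i j
  proof (induction j rule: less_induct)
    case (less j)
    show ?case
    proof (cases "j < m")
      case True
      then show ?thesis using 1 by blast
    next
      case False
      have span: "(\<Sum>k<m. h k * (x ^ i * y ^ (k + (j - m)))) \<in> span_mod B"
        using False y(3) by (intro span_sum[OF B] span_smult[OF B] less.IH) auto
      have "t * (x ^ i * y ^ j) - (\<Sum>k<m. h k * (x ^ i * y ^ (k + (j - m))))
          = (t * y ^ m - (\<Sum>k<m. h k * y ^ k)) * (x ^ i * y ^ (j - m))"
      proof -
        have "y ^ j = y ^ m * y ^ (j - m)" using False by (simp flip: power_add)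
        show ?thesis
          unfolding left_diff_distrib sum_distrib_right power_add \<open>y ^ j = _\<close> by (simp only: mult_ac)
      qed
      moreover have "(t * y ^ m - (\<Sum>k<m. h k * y ^ k)) * (x ^ i * y ^ (j - m)) \<in> J"
        using y(4) xy by (intro J_mult2) (auto intro!: CI)
      ultimately have "t * (x ^ i * y ^ j) - (\<Sum>k<m. h k * (x ^ i * y ^ (k + (j - m)))) \<in> J"
        by (simp only:)
      moreover have "x ^ i * y ^ j \<in> C" using xy by (intro CI)
      ultimately show ?thesis
        using span_divide[OF B y(1,2)] span by blast
    qed
  qed
  show ?thesis using that B 2 by blast
qed

text \<open>The powers of \<open>x * y\<close> are monomials in \<open>x\<close> and
  \<open>y\<close>, so they lie in one finite span.\<close>

lemma alg_mult:
  assumes "alg x" "alg y"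
  shows "alg (x * y)"
proof -
  obtain B where B: "finite B" "B \<subseteq> C" "\<And>i j. x ^ i * y ^ j \<in> span_mod B"
    using assms by (rule alg_finite_span) blast
  then show ?thesis
    using assms[THEN alg_in_C]
    by (intro alg_if_powers_in_span[of B]) (auto simp: power_mult_distrib intro: CI)
qed

text \<open>The binomial theorem writes the powers of \<open>x + y\<close> through monomials with
  coefficients in \<open>L\<close>.\<close>

lemma alg_add:
  assumes "alg x" "alg y"
  shows "alg (x + y)"
proof -
  obtain B where B: "finite B" "B \<subseteq> C" "\<And>i j. x ^ i * y ^ j \<in> span_mod B"
    using assms by (rule alg_finite_span) blast
  have "(x + y) ^ k \<in> span_mod B" for k
    unfolding binomial_ring mult.assoc
    by (intro span_sum[OF B(1,2)] span_smult[OF B(1,2) LI(9)] B(3))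
  then show ?thesis
    using assms[THEN alg_in_C] B by (intro alg_if_powers_in_span[of B]) (auto intro: CI)
qed

lemma alg_base: "x \<in> L \<Longrightarrow> alg x"
proof -
  assume x: "x \<in> L"
  have "(\<Sum>i\<le>1. (if i = 0 then - x else 1) * x ^ i) = 0" by simp
  then show "alg x"
    unfolding alg_def using x inC LI J_zero one_notin_J
    by (auto intro!: exI[of _ "1::nat"] exI[of _ "\<lambda>i. if i = (0::nat) then - x else 1"])
qed

text \<open>Cancel the largest power of \<open>x\<close> from a relation modulo \<open>J\<close>; the new constant term is \<open>u\<close>.\<close>
lemma alg_multiple:
  assumes "alg x" "x \<notin> J"
  obtains c u where "c \<in> C" "u \<in> L" "u \<notin> J" "u - c * x \<in> J"
proof -
  obtain n h where h: "x \<in> C" "\<forall>i. h i \<in> L" "\<exists>i\<le>n. h i \<notin> J" "(\<Sum>i\<le>n. h i * x ^ i) \<in> J"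
    using assms by (auto simp: alg_def)
  \<comment> \<open>Terms before \<open>d\<close> lie in \<open>J\<close> and terms after it are
    divisible by \<open>x ^ Suc d\<close>, so modulo \<open>J\<close> the factor
    \<open>x ^ d\<close> splits off and leaves \<open>h d + r * x\<close>.\<close>
  define d where "d = (LEAST i. i \<le> n \<and> h i \<notin> J)"
  have d: "d \<le> n" "h d \<notin> J" "\<And>i. i < d \<Longrightarrow> h i \<in> J"
    using LeastI_ex[OF h(3)] not_less_Least[of _ "\<lambda>i. i \<le> n \<and> h i \<notin> J"]
    unfolding d_def[symmetric] by force+
  define r where "r = (\<Sum>i\<in>{d<..n}. h i * x ^ (i - Suc d))"
  have "{..n} = {..<d} \<union> {d} \<union> {d<..n}" using d by auto
  then have "(\<Sum>i\<le>n. h i * x ^ i) = (\<Sum>i\<in>{..<d} \<union> {d} \<union> {d<..n}. h i * x ^ i)" by simp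
  also have "\<dots> = (\<Sum>i<d. h i * x ^ i) + h d * x ^ d + (\<Sum>i\<in>{d<..n}. h i * x ^ i)"
    by (subst sum.union_disjoint; (subst sum.union_disjoint)?) auto
  also have "(\<Sum>i\<in>{d<..n}. h i * x ^ i) = (\<Sum>i\<in>{d<..n}. x ^ Suc d * (h i * x ^ (i - Suc d)))"
  proof (intro sum.cong refl)
    fix i assume "i \<in> {d<..n}"
    then have "x ^ i = x ^ Suc d * x ^ (i - Suc d)" by (simp only: power_add[symmetric]) simp
    then show "h i * x ^ i = x ^ Suc d * (h i * x ^ (i - Suc d))" by (simp only: mult_ac)
  qed
  also have "\<dots> = x ^ d * (r * x)"
    by (simp add: r_def sum_distrib_right sum_distrib_left mult_ac)
  finally have eq: "x ^ d * (h d + r * x) = (\<Sum>i\<le>n. h i * x ^ i) - (\<Sum>i<d. h i * x ^ i)"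
    by (simp add: algebra_simps)
  have r: "r \<in> C" unfolding r_def using h(1,2) by (intro CI(7) CI(3) CI(8)) (auto intro: inC)
  have "x ^ d * (h d + r * x) \<in> J"
    unfolding eq using d h by (auto intro!: J_diff J_sum J_mult2 CI)
  moreover have "x ^ k \<notin> J" for k
    using one_notin_J assms(2) h(1) prime_mult CI(8) by (induction k) auto
  ultimately have "h d + r * x \<in> J"
    using prime_mult[of "x ^ d" "h d + r * x"] CI(6)[OF inC CI(3)] CI(8) h(1,2) r by simp
  then show ?thesis using that[of "- r" "h d"] r h d by (auto intro: CI)
qed

end

subsection \<open>Polynomials with coefficients in a subset\<close>

definition poly_set :: "'t::zero set \<Rightarrow> 't poly set" where
  "poly_set A = {f. \<forall>i. coeff f i \<in> A}"

lemma poly_set_mono: "A \<subseteq> B \<Longrightarrow> poly_set A \<subseteq> poly_set B"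
  by (auto simp: poly_set_def)

lemma pCons_in_poly_set: "pCons a f \<in> poly_set A \<longleftrightarrow> a \<in> A \<and> f \<in> poly_set A"
  by (auto simp: poly_set_def coeff_pCons split: nat.splits)

lemma zero_in_poly_set: "0 \<in> poly_set A \<longleftrightarrow> 0 \<in> A"
  by (auto simp: poly_set_def)

lemma poly_set_induct [consumes 1, case_names zero pCons]:
  assumes "f \<in> poly_set A" "P 0" "\<And>a g. a \<in> A \<Longrightarrow> g \<in> poly_set A \<Longrightarrow> P g \<Longrightarrow> P (pCons a g)"
  shows "P f"
  using assms(1) by (induction f) (auto simp: pCons_in_poly_set assms)

lemma is_subring_poly_set: "is_subring C \<Longrightarrow> is_subring (poly_set C)"
  unfolding is_subring_def[of "poly_set C"]
  by (auto simp: poly_set_def coeff_mult coeff_1 intro!: subring_closed[of C])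

lemma is_ideal_poly_set: "is_subring C \<Longrightarrow> is_ideal C J \<Longrightarrow> is_ideal (poly_set C) (poly_set J)"
  unfolding is_ideal_def[of "poly_set C"]
  by (auto simp: poly_set_def coeff_mult intro: ideal_closed[of C J] ideal_mem[of C J])

text \<open>Gauss's argument: if \<open>i\<close> and \<open>j\<close> are the first indices of
  coefficients outside \<open>J\<close>, then coefficient \<open>i + j\<close> of the product is
  congruent to the product of these two coefficients.\<close>

lemma is_prime_poly_set:
  assumes C: "is_subring C" and J: "is_prime C J"
  shows "is_prime (poly_set C) (poly_set J)"
proof -
  note I = is_prime_ideal[OF J]
  have "f \<in> poly_set J \<or> g \<in> poly_set J"
    if f: "f \<in> poly_set C" and g: "g \<in> poly_set C" and fg: "f * g \<in> poly_set J" for f g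
  proof (rule ccontr)
    assume *: "\<not> ?thesis"
    define i where "i = (LEAST i. coeff f i \<notin> J)"
    define j where "j = (LEAST j. coeff g j \<notin> J)"
    have ex: "\<exists>i. coeff f i \<notin> J" "\<exists>j. coeff g j \<notin> J"
      using * by (simp_all add: poly_set_def)
    have i: "coeff f i \<notin> J" "\<And>k. k < i \<Longrightarrow> coeff f k \<in> J"
      unfolding i_def using LeastI_ex[OF ex(1)] not_less_Least[of _ "\<lambda>i. coeff f i \<notin> J"] by blast+
    have j: "coeff g j \<notin> J" "\<And>k. k < j \<Longrightarrow> coeff g k \<in> J"
      unfolding j_def using LeastI_ex[OF ex(2)] not_less_Least[of _ "\<lambda>i. coeff g i \<notin> J"] by blast+
    have "coeff (f * g) (i + j) = (\<Sum>k\<in>insert i ({..i+j} - {i}). coeff f k * coeff g (i + j - k))"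
      by (simp add: coeff_mult insert_absorb)
    also have "\<dots> = coeff f i * coeff g j + (\<Sum>k\<in>{..i+j} - {i}. coeff f k * coeff g (i + j - k))"
      by (subst sum.insert) auto
    finally have eq: "coeff f i * coeff g j =
        coeff (f * g) (i + j) - (\<Sum>k\<in>{..i+j} - {i}. coeff f k * coeff g (i + j - k))"
      by simp
    have "coeff f k * coeff g (i + j - k) \<in> J" if "k \<in> {..i+j} - {i}" for k
    proof (cases "k < i")
      case True
      then show ?thesis using i(2) g by (auto simp: poly_set_def intro: ideal_mult2[OF C I])
    next
      case False
      then have "i + j - k < j" using that by auto
      then show ?thesis using j(2) f by (auto simp: poly_set_def intro: ideal_mult[OF C I])
    qed
    then have "coeff f i * coeff g j \<in> J"
      unfolding eq using fg by (intro ideal_diff[OF C I] ideal_sum[OF C I]) (auto simp: poly_set_def)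
    then show False using i(1) j(1) f g J by (auto simp: is_prime_def poly_set_def)
  qed
  moreover have "1 \<notin> poly_set J" using J by (auto simp: is_prime_def poly_set_def coeff_1)
  ultimately show ?thesis using is_ideal_poly_set[OF C I] by (auto simp: is_prime_def)
qed

lemma finite_range_coeff: "finite (range (coeff f))"
proof -
  have "range (coeff f) \<subseteq> insert 0 (coeff f ` {..degree f})"
    by (force intro: coeff_eq_0 simp: not_le)
  then show ?thesis by (rule finite_subset) auto
qed

definition coeffs2 :: "'t::zero poly poly \<Rightarrow> 't set" where
  "coeffs2 f = (\<Union>g\<in>range (coeff f). range (coeff g))"

lemma finite_coeffs2: "finite (coeffs2 f)"
  unfolding coeffs2_def by (intro finite_UN_I finite_range_coeff)

lemma poly_set2_iff: "f \<in> poly_set (poly_set A) \<longleftrightarrow> coeffs2 f \<subseteq> A"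
  by (auto simp: poly_set_def coeffs2_def)

text \<open>For a subring \<open>C\<close> this is \<open>C[t]\<close>; for an ideal
  \<open>J\<close> of \<open>C\<close> it is the ideal of \<open>C[t]\<close> generated by
  \<open>J\<close>.\<close>

definition adjoin :: "'t::comm_ring_1 \<Rightarrow> 't set \<Rightarrow> 't set" where
  "adjoin t A = (\<lambda>f. poly f t) ` poly_set A"

lemma adjoinI: "f \<in> poly_set A \<Longrightarrow> poly f t \<in> adjoin t A"
  by (simp add: adjoin_def)

lemma adjoinE:
  assumes "x \<in> adjoin t A"
  obtains f where "f \<in> poly_set A" "x = poly f t"
  using assms by (auto simp: adjoin_def)

lemma is_subring_adjoin:
  assumes "is_subring C"
  shows "is_subring (adjoin t C)"
proof -
  note S = is_subring_poly_set[OF assms]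
  show ?thesis
    unfolding is_subring_def
    using adjoinI[OF subring_one[OF S], of t] adjoinI[OF subring_diff[OF S], of _ _ t]
      adjoinI[OF subring_mult[OF S], of _ _ t]
    by (auto elim!: adjoinE)
qed

lemma is_ideal_adjoin:
  assumes "is_subring C" "is_ideal C J"
  shows "is_ideal (adjoin t C) (adjoin t J)"
proof -
  note S = is_subring_poly_set[OF assms(1)] and I = is_ideal_poly_set[OF assms]
  show ?thesis
    unfolding is_ideal_def
    using adjoinI[OF ideal_zero[OF S I], of t] adjoinI[OF ideal_add[OF S I], of _ _ t]
      adjoinI[OF ideal_mult[OF S I], of _ _ t] adjoinI[OF ideal_mem[OF S I], of _ t]
    by (auto elim!: adjoinE)
qed

lemma subset_adjoin: "0 \<in> A \<Longrightarrow> A \<subseteq> adjoin t A"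
proof
  fix x assume "0 \<in> A" "x \<in> A"
  then have "[:x:] \<in> poly_set A" by (simp add: pCons_in_poly_set zero_in_poly_set)
  moreover have "poly [:x:] t = x" by simp
  ultimately show "x \<in> adjoin t A" unfolding adjoin_def by (metis image_eqI)
qed

lemma in_adjoin: "is_subring C \<Longrightarrow> t \<in> adjoin t C"
proof -
  assume "is_subring C"
  then have "[:0, 1:] \<in> poly_set C"
    by (simp add: pCons_in_poly_set zero_in_poly_set subring_zero subring_one)
  moreover have "poly [:0, 1:] t = t" by simp
  ultimately show ?thesis unfolding adjoin_def by (metis image_eqI)
qed

text \<open>Regrouping \<open>J[t][Y]\<close> as \<open>J[Y][t]\<close>. Two applications carry an
  adjoined element of the ground field past both polynomial variables.\<close>

lemma poly_set_adjoin:
  assumes "is_subring C" "is_ideal C J"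
  shows "poly_set (adjoin t J) \<subseteq> adjoin [:t:] (poly_set J)"
proof
  note I = is_ideal_poly_set[OF assms]
  note S = is_subring_poly_set[OF assms(1)]
  note I2 = is_ideal_poly_set[OF S I]
  note S2 = is_subring_poly_set[OF S]
  \<comment> \<open>\<open>E\<close> is \<open>e\<close> with each coefficient turned into a
    constant polynomial.\<close>
  have const: "\<exists>E\<in>poly_set (poly_set J). poly E [:t:] = [:poly e t:]" if "e \<in> poly_set J" for e
    using that
  proof (induction e rule: poly_set_induct)
    case zero
    show ?case using ideal_zero[OF S2 I2] by (intro bexI[of _ 0]) auto
  next
    case (pCons a g)
    then obtain E where E: "E \<in> poly_set (poly_set J)" "poly E [:t:] = [:poly g t:]" by auto
    then have "pCons [:a:] E \<in> poly_set (poly_set J)"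
      using pCons ideal_zero[OF assms] by (simp add: pCons_in_poly_set zero_in_poly_set)
    moreover have "poly (pCons [:a:] E) [:t:] = [:poly (pCons a g) t:]" using E by simp
    ultimately show ?case by blast
  qed
  fix f assume "f \<in> poly_set (adjoin t J)"
  then have "\<exists>F\<in>poly_set (poly_set J). poly F [:t:] = f"
  proof (induction f rule: poly_set_induct)
    case zero
    show ?case using ideal_zero[OF S2 I2] by (intro bexI[of _ 0]) auto
  next
    case (pCons a g)
    then obtain F where F: "F \<in> poly_set (poly_set J)" "poly F [:t:] = g" by auto
    obtain E where E: "E \<in> poly_set (poly_set J)" "poly E [:t:] = [:a:]"
      using const pCons(1) unfolding adjoin_def by auto
    have "[:[:0, 1:]:] \<in> poly_set (poly_set C)"
      using assms(1) by (simp add: pCons_in_poly_set zero_in_poly_set subring_zero subring_one)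
    then have "E + [:[:0, 1:]:] * F \<in> poly_set (poly_set J)"
      using E F by (intro ideal_add[OF S2 I2] ideal_mult[OF S2 I2])
    moreover have "poly (E + [:[:0, 1:]:] * F) [:t:] = pCons a g"
      using E F by simp
    ultimately show ?case by blast
  qed
  then show "f \<in> adjoin [:t:] (poly_set J)" unfolding adjoin_def by blast
qed

definition ideal_plus :: "'t::comm_ring_1 \<Rightarrow> 't set \<Rightarrow> 't set \<Rightarrow> 't set" where
  "ideal_plus a C J = {x + a * c | x c. x \<in> J \<and> c \<in> C}"

lemma is_ideal_ideal_plus:
  assumes C: "is_subring C" and J: "is_ideal C J" and a: "a \<in> C"
  shows "is_ideal C (ideal_plus a C J)"
proof -
  have "x + a * c \<in> C" if "x \<in> J" "c \<in> C" for x c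
    using that a by (intro subring_closed[OF C]) (auto intro: ideal_mem[OF C J])
  moreover have "0 \<in> ideal_plus a C J"
    unfolding ideal_plus_def using ideal_zero[OF C J] subring_zero[OF C] by force
  moreover have "(x + a * c) + (y + a * d) \<in> ideal_plus a C J"
    if "x \<in> J" "c \<in> C" "y \<in> J" "d \<in> C" for x y c d
  proof -
    have "(x + a * c) + (y + a * d) = (x + y) + a * (c + d)" by (simp add: algebra_simps)
    then show ?thesis unfolding ideal_plus_def
      using that ideal_add[OF C J] subring_add[OF C] by blast
  qed
  moreover have "e * (x + a * c) \<in> ideal_plus a C J"
    if "x \<in> J" "c \<in> C" "e \<in> C" for x c e
  proof -
    have "e * (x + a * c) = e * x + a * (e * c)" by (simp add: algebra_simps)
    then show ?thesis unfolding ideal_plus_def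
      using that ideal_mult[OF C J] subring_mult[OF C] by blast
  qed
  ultimately show ?thesis
    by (auto simp: is_ideal_def) (auto simp: ideal_plus_def)
qed

text \<open>Each coefficient is split separately. As with \<open>adjoin\<close>, two applications
  pass from the ground ring to two variables.\<close>

lemma poly_set_ideal_plus:
  assumes "0 \<in> J" "0 \<in> C"
  shows "poly_set (ideal_plus a C J) \<subseteq> ideal_plus [:a:] (poly_set C) (poly_set J)"
proof
  fix f assume "f \<in> poly_set (ideal_plus a C J)"
  then show "f \<in> ideal_plus [:a:] (poly_set C) (poly_set J)"
  proof (induction f rule: poly_set_induct)
    case zero
    have "0 = 0 + [:a:] * 0" by simp
    then show ?case unfolding ideal_plus_def using assms zero_in_poly_set by blast
  next
    case (pCons b g)
    then obtain x c y d where *: "b = x + a * c" "x \<in> J" "c \<in> C" "g = y + [:a:] * d"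
        "y \<in> poly_set J" "d \<in> poly_set C"
      by (auto simp: ideal_plus_def)
    then have "pCons b g = pCons x y + [:a:] * pCons c d" by (simp add: algebra_simps)
    moreover have "pCons x y \<in> poly_set J" "pCons c d \<in> poly_set C"
      using * by (simp_all add: pCons_in_poly_set)
    ultimately show ?case unfolding ideal_plus_def by blast
  qed
qed

subsection \<open>Extending a ring by an element or its inverse\<close>

text \<open>Chevalley's argument that \<open>t\<close> or its inverse can be adjoined without the
  ideal becoming improper. Here \<open>1\<close> is replaced by the multiplicative set
  \<open>U\<close> and equality by congruence modulo \<open>I\<close>: a pair of relations of least
  exponents could be shortened further.\<close>

lemma not_both_meet:
  fixes C J I U :: "'t::comm_ring_1 set"
  assumes C: "is_subring C" and J: "is_ideal C J" and I: "is_ideal UNIV I"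
    and U: "U \<subseteq> C" "\<And>u v. u \<in> U \<Longrightarrow> v \<in> U \<Longrightarrow> u * v \<in> U"
    and disj: "\<And>j n. j \<in> J \<Longrightarrow> n \<in> I \<Longrightarrow> j + n \<notin> U"
    and t: "t * t' = 1"
    and meet: "f \<in> adjoin t J" "n \<in> I" "f + n \<in> U" "f' \<in> adjoin t' J" "n' \<in> I" "f' + n' \<in> U"
  shows False
proof -
  have UNIV: "is_subring (UNIV :: 't set)" by (simp add: is_subring_def)
  \<comment> \<open>The sum starts at exponent 1, since the constant term is absorbed into
    \<open>j\<close>; exponent 0 therefore contradicts \<open>disj\<close>.\<close>
  define rep where "rep = (\<lambda>t n. \<exists>u j a. u \<in> U \<and> j \<in> J \<and> (\<forall>i. a i \<in> J) \<and>
      u + j - (\<Sum>i=1..n. a i * t ^ i) \<in> I)"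
  have rep0: "\<not> rep t 0" for t
  proof
    assume "rep t 0"
    then obtain u j where "u \<in> U" "j \<in> J" "u + j \<in> I" by (auto simp: rep_def)
    then show False using disj[of "- j" "u + j"] ideal_uminus[OF C J] by auto
  qed
  text \<open>The relation with the smaller exponent removes the top power from the other one.\<close>
  have lower: "rep t (n - 1)" if t: "t * t' = 1" and "rep t n" "rep t' m" "0 < m" "m \<le> n" for t t' n m
  proof -
    obtain u j a where 1: "u \<in> U" "j \<in> J" "\<forall>i. a i \<in> J" "u + j - (\<Sum>i=1..n. a i * t ^ i) \<in> I"
      using \<open>rep t n\<close> by (auto simp: rep_def)
    obtain v k b where 2: "v \<in> U" "k \<in> J" "\<forall>i. b i \<in> J" "v + k - (\<Sum>i=1..m. b i * t' ^ i) \<in> I"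
      using \<open>rep t' m\<close> by (auto simp: rep_def)
    define w where "w = v + k"
    \<comment> \<open>The first relation is multiplied by \<open>w\<close>, and in its top term
      \<open>a n * t ^ n * w\<close> the factor \<open>w\<close> is replaced by the second relation.
      The powers \<open>t ^ (n - i)\<close> that arise account for the second summand;
      \<open>c 0\<close> can be nonzero only when \<open>m = n\<close>.\<close>
    define c where "c = (\<lambda>l. (if l = 0 then 0 else a l * w) + (if n - l \<le> m then a n * b (n - l) else 0))"
    have wC: "w \<in> C" unfolding w_def using 2 U(1) ideal_mem[OF C J] by (intro subring_add[OF C]) auto
    have uC: "u \<in> C" using 1 U(1) by auto
    have vC: "v \<in> C" using 2 U(1) by auto
    have aC: "a i \<in> C" for i using 1 ideal_mem[OF C J] by auto
    have bC: "b i \<in> C" for i using 2 ideal_mem[OF C J] by auto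
    have cJ: "c l \<in> J" for l
      unfolding c_def using 1 2 wC aC bC
      by (auto intro!: ideal_closed[OF C J] simp del: mult_eq_0_iff)
    have pw: "t ^ n * t' ^ i = t ^ (n - i)" if "i \<le> n" for i
    proof -
      have "t ^ n * t' ^ i = t ^ (n - i) * (t * t') ^ i"
        unfolding power_mult_distrib mult.assoc[symmetric] power_add[symmetric] using that by simp
      then show ?thesis using t by simp
    qed
    have "(\<Sum>l=1..n. a l * t ^ l) * w = (\<Sum>l=1..n-1. a l * w * t ^ l) + a n * t ^ n * w"
      using that(4,5) by (cases n) (auto simp: sum_distrib_left distrib_right mult_ac distrib_left)
    moreover have "(\<Sum>l=0..n-1. c l * t ^ l) =
        (\<Sum>l=1..n-1. a l * w * t ^ l) + (\<Sum>i=1..m. a n * b i * t ^ (n - i))"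
    proof -
      have "(\<Sum>l=0..n-1. c l * t ^ l) = (\<Sum>l=0..n-1. (if l = 0 then 0 else a l * w) * t ^ l)
          + (\<Sum>l=0..n-1. (if n - l \<le> m then a n * b (n - l) else 0) * t ^ l)"
        by (simp add: c_def distrib_right sum.distrib)
      also have "(\<Sum>l=0..n-1. (if l = 0 then 0 else a l * w) * t ^ l) = (\<Sum>l=1..n-1. a l * w * t ^ l)"
        by (intro sum.mono_neutral_cong_right) auto
      also have "(\<Sum>l=0..n-1. (if n - l \<le> m then a n * b (n - l) else 0) * t ^ l)
          = (\<Sum>l\<in>{n-m..n-1}. a n * b (n - l) * t ^ l)"
        by (intro sum.mono_neutral_cong_right) auto
      also have "\<dots> = (\<Sum>i=1..m. a n * b i * t ^ (n - i))"
        using that(4,5) by (intro sum.reindex_bij_witness[of _ "\<lambda>i. n - i" "\<lambda>i. n - i"]) auto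
      finally show ?thesis .
    qed
    moreover have "(\<Sum>i=1..m. a n * b i * t ^ (n - i)) = a n * t ^ n * (\<Sum>i=1..m. b i * t' ^ i)"
      unfolding sum_distrib_left using that(5)
      by (intro sum.cong refl) (simp add: pw[symmetric] mult_ac)
    ultimately have "(u + j) * w - (\<Sum>l=0..n-1. c l * t ^ l) =
        w * (u + j - (\<Sum>l=1..n. a l * t ^ l)) + (a n * t ^ n) * (w - (\<Sum>i=1..m. b i * t' ^ i))"
      by (simp add: algebra_simps)
    also have "\<dots> \<in> I"
      using 1(4) 2(4) by (intro ideal_add[OF UNIV I] ideal_mult[OF UNIV I]) (auto simp: w_def)
    finally have "(u + j) * w - (\<Sum>l=0..n-1. c l * t ^ l) \<in> I" .
    moreover have "(\<Sum>l=0..n-1. c l * t ^ l) = c 0 + (\<Sum>l=1..n-1. c l * t ^ l)"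
      by (simp add: sum.atLeast_Suc_atMost)
    \<comment> \<open>The new left side again has the form of an element of \<open>U\<close> plus
      one of \<open>J\<close>.\<close>
    moreover have "(u + j) * w = u * v + (u * k + j * w)" by (simp add: w_def algebra_simps)
    ultimately have "u * v + (u * k + j * w - c 0) - (\<Sum>l=1..n-1. c l * t ^ l) \<in> I"
      by (simp add: algebra_simps)
    moreover have "u * k + j * w - c 0 \<in> J"
      using 1 2 cJ wC uC by (intro ideal_diff[OF C J] ideal_add[OF C J])
        (auto intro: ideal_mult[OF C J] ideal_mult2[OF C J])
    moreover have "u * v \<in> U" using 1 2 U by auto
    ultimately show ?thesis unfolding rep_def using cJ by blast
  qed
  have no_rep: "\<not> (rep t n \<and> rep t' m)" if "t * t' = 1" for t t' n m
    using that
  proof (induction "n + m" arbitrary: n m t t' rule: less_induct)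
    case less
    show ?case
    proof
      assume *: "rep t n \<and> rep t' m"
      then have "0 < n" "0 < m" using rep0 by (metis neq0_conv)+
      show False
      proof (cases "m \<le> n")
        case True
        then have "rep t (n - 1)" using lower[OF less.prems] * \<open>0 < m\<close> by blast
        then show False using less.hyps[of "n - 1" m t t'] less.prems * \<open>0 < n\<close> by auto
      next
        case False
        have "t' * t = 1" using less.prems by (simp add: mult.commute)
        then have "rep t' (m - 1)" using lower[of t' t m n] * \<open>0 < n\<close> False by auto
        then show False using less.hyps[of n "m - 1" t t'] less.prems * \<open>0 < m\<close> by auto
      qed
    qed
  qed
  have rep: "rep t (degree e)" if "e \<in> poly_set J" "n \<in> I" "poly e t + n \<in> U" for e n t
  proof -
    have "poly e t = coeff e 0 + (\<Sum>i=1..degree e. coeff e i * t ^ i)"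
      unfolding poly_altdef atLeast0AtMost[symmetric] by (simp add: sum.atLeast_Suc_atMost)
    then have "(poly e t + n) + (- coeff e 0) - (\<Sum>i=1..degree e. coeff e i * t ^ i) \<in> I"
      using that(2) by simp
    moreover have "- coeff e 0 \<in> J" "\<forall>i. coeff e i \<in> J"
      using that(1) by (auto simp: poly_set_def intro: ideal_uminus[OF C J])
    ultimately show ?thesis unfolding rep_def using that(3) by blast
  qed
  show False
    using meet rep no_rep[OF t] unfolding adjoin_def by blast
qed

subsection \<open>A domain whose fraction field is residually algebraic\<close>

text \<open>In a valuation ring divisibility is total, so a finite set has an element of least
  value.\<close>

lemma exists_dividing_coeff:
  fixes A E :: "'k::field set"
  assumes "finite A" "A \<noteq> {}" "0 \<notin> A" and E: "is_subring E"
    and val: "\<And>t. t \<noteq> 0 \<Longrightarrow> t \<in> E \<or> inverse t \<in> E"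
  shows "\<exists>c\<in>A. \<forall>x\<in>A. x / c \<in> E"
  using assms(1-3)
proof (induction A rule: finite_ne_induct)
  case (singleton x)
  then show ?case using subring_one[OF E] by auto
next
  case (insert y A)
  then obtain c where c: "c \<in> A" "\<forall>x\<in>A. x / c \<in> E" by auto
  then have nz: "c \<noteq> 0" "y \<noteq> 0" using insert by auto
  show ?case
  proof (cases "y / c \<in> E")
    case True
    then show ?thesis using c by auto
  next
    case False
    then have cy: "c / y \<in> E" using val[of "y / c"] nz by (simp add: divide_simps)
    have "x / y \<in> E" if "x \<in> A" for x
      using subring_mult[OF E, of "x / c" "c / y"] c that cy nz by simp
    then show ?thesis using subring_one[OF E] nz by auto
  qed
qed

text \<open>In \<open>'k poly poly\<close> the inner variable is \<open>X\<close> and the outer one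
  is \<open>Y\<close>. The ideal \<open>I\<close> plays the role of \<open>N K[X,Y]\<close>, and the
  aim is to show that it vanishes.\<close>

locale algebraic_residue =
  fixes D q :: "'k::field set" and I :: "'k poly poly set"
  assumes D: "is_subring D" and q: "is_prime D q" and I: "is_ideal UNIV I"
    and I_D: "\<And>u. u \<in> I \<Longrightarrow> u \<in> poly_set (poly_set D) \<Longrightarrow> u \<in> poly_set (poly_set q)"
    and alg_q: "\<And>t. \<exists>g\<in>poly_set D. g \<notin> poly_set q \<and> poly g t = 0"
begin

abbreviation "p2 A \<equiv> poly_set (poly_set A)"

definition "U = p2 D - p2 q"

lemmas p2_subring = is_subring_poly_set[OF is_subring_poly_set]
lemmas p2_ideal = is_ideal_poly_set[OF is_subring_poly_set is_ideal_poly_set]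
lemmas p2_prime = is_prime_poly_set[OF is_subring_poly_set is_prime_poly_set]

lemma UNIV: "is_subring (UNIV :: 'k poly poly set)"
  by (simp add: is_subring_def)

lemma U_mult: "u \<in> U \<Longrightarrow> v \<in> U \<Longrightarrow> u * v \<in> U"
  using p2_prime[OF D D q] subring_mult[OF p2_subring[OF D]] by (auto simp: U_def is_prime_def)

lemma one_in_U: "1 \<in> U"
  using p2_prime[OF D D q] subring_one[OF p2_subring[OF D]] by (auto simp: U_def is_prime_def)

text \<open>Maximal pairs \<open>E\<close>, \<open>p\<close> with this property are valuation rings with prime \<open>p\<close>;
  the usual domination order is replaced by disjointness of \<open>p[X,Y] + I\<close> from \<open>D[X,Y] - q[X,Y]\<close>.\<close>
definition good :: "'k set \<Rightarrow> 'k set \<Rightarrow> bool" where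
  "good E p \<longleftrightarrow> is_subring E \<and> D \<subseteq> E \<and> is_ideal E p \<and> q \<subseteq> p \<and> (\<forall>j\<in>p2 p. \<forall>n\<in>I. j + n \<notin> U)"

text \<open>If \<open>j + n\<close> has coefficients in \<open>D\<close>, then so does
  \<open>n\<close>, and \<open>I_D\<close> puts it into \<open>q[X,Y]\<close>.\<close>

lemma good_D_q: "good D q"
proof -
  have "j + n \<notin> U" if j: "j \<in> p2 q" and n: "n \<in> I" for j n
  proof
    assume u: "j + n \<in> U"
    note S = p2_subring[OF D] and Q = p2_ideal[OF D D is_prime_ideal[OF q]]
    have "j \<in> p2 D" using j by (rule ideal_mem[OF S Q])
    then have "(j + n) - j \<in> p2 D" using u by (intro subring_diff[OF S]) (auto simp: U_def)
    then have "n \<in> p2 q" using I_D n by simp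
    then have "j + n \<in> p2 q" using j by (intro ideal_add[OF S Q])
    then show False using u by (simp add: U_def)
  qed
  then show ?thesis using D q by (auto simp: good_def is_prime_ideal)
qed

text \<open>Every condition in \<open>good\<close> concerns finitely many elements at a time; in
  particular a polynomial over the union of a chain already has its coefficients in one member.
  Unions of chains are thus good.\<close>

lemma ex_maximal_good:
  obtains E p where "good E p" "\<And>E' p'. good E' p' \<Longrightarrow> E \<subseteq> E' \<Longrightarrow> p \<subseteq> p' \<Longrightarrow> E' = E \<and> p' = p"
proof -
  \<comment> \<open>A pair of sets is one subset of the sum type, so Zorn's lemma for inclusion applies.\<close>
  define F where "F = {M :: ('k + 'k) set. good (Inl -` M) (Inr -` M)}"
  have "F \<noteq> {}"
  proof -
    have "Inl -` (Inl ` D \<union> Inr ` q) = D" "Inr -` (Inl ` D \<union> Inr ` q) = q" by auto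
    then show ?thesis using good_D_q unfolding F_def by (metis empty_iff mem_Collect_eq)
  qed
  moreover have "\<Union>\<C> \<in> F" if ne: "\<C> \<noteq> {}" and ch: "subset.chain F \<C>" for \<C>
  proof -
    have gd: "good (Inl -` M) (Inr -` M)" if "M \<in> \<C>" for M
      using ch that by (auto simp: F_def subset.chain_def)
    have fin: "\<exists>M\<in>\<C>. A \<subseteq> M" if "finite A" "A \<subseteq> \<Union>\<C>" for A
      using finite_subset_Union_chain[OF that ne ch] by metis
    obtain M0 where M0: "M0 \<in> \<C>" using ne by auto
    let ?E = "Inl -` \<Union>\<C>" and ?p = "Inr -` \<Union>\<C>"
    have "is_subring ?E"
      unfolding is_subring_def
    proof (intro conjI ballI)
      show "1 \<in> ?E" using gd[OF M0] M0 by (auto simp: good_def is_subring_def)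
      fix x y assume "x \<in> ?E" "y \<in> ?E"
      then obtain M where "M \<in> \<C>" "Inl x \<in> M" "Inl y \<in> M" using fin[of "{Inl x, Inl y}"] by auto
      then show "x - y \<in> ?E" "x * y \<in> ?E" using gd[of M] by (auto simp: good_def is_subring_def)
    qed
    moreover have "is_ideal ?E ?p"
      unfolding is_ideal_def
    proof (intro conjI ballI subsetI)
      show "0 \<in> ?p" using gd[OF M0] M0 by (auto simp: good_def is_ideal_def)
      show "x \<in> ?E" if x: "x \<in> ?p" for x
      proof -
        obtain M where "M \<in> \<C>" "Inr x \<in> M" using x by auto
        then show ?thesis using gd[of M] by (auto simp: good_def is_ideal_def)
      qed
      fix x assume x: "x \<in> ?p"
      show "x + y \<in> ?p" if y: "y \<in> ?p" for y
      proof -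
        obtain M where M: "M \<in> \<C>" "Inr x \<in> M" "Inr y \<in> M"
          using fin[of "{Inr x, Inr y}"] x y by auto
        then have "x + y \<in> Inr -` M" using gd[of M] by (simp add: good_def is_ideal_def)
        then show ?thesis using M by auto
      qed
    next
      fix c x assume "c \<in> ?E" "x \<in> ?p"
      then obtain M where M: "M \<in> \<C>" "Inl c \<in> M" "Inr x \<in> M"
        using fin[of "{Inl c, Inr x}"] by auto
      then have "c * x \<in> Inr -` M" using gd[of M] by (simp add: good_def is_ideal_def)
      then show "c * x \<in> ?p" using M by auto
    qed
    moreover have "j + n \<notin> U" if j: "j \<in> p2 ?p" and n: "n \<in> I" for j n
    proof -
      have "finite (Inr ` coeffs2 j :: ('k + 'k) set)" by (intro finite_imageI finite_coeffs2)
      moreover have "Inr ` coeffs2 j \<subseteq> \<Union>\<C>" using j unfolding poly_set2_iff by auto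
      ultimately obtain M where "M \<in> \<C>" "Inr ` coeffs2 j \<subseteq> M" using fin by blast
      then have "j \<in> p2 (Inr -` M)" unfolding poly_set2_iff by auto
      then show ?thesis using gd[OF \<open>M \<in> \<C>\<close>] n by (auto simp: good_def)
    qed
    moreover have "D \<subseteq> ?E" "q \<subseteq> ?p" using gd[OF M0] M0 by (auto simp: good_def)
    ultimately show ?thesis by (simp add: F_def good_def)
  qed
  ultimately obtain M where M: "M \<in> F" "\<And>N. N \<in> F \<Longrightarrow> M \<subseteq> N \<Longrightarrow> N = M"
    using subset_Zorn_nonempty[of F] by metis
  show ?thesis
  proof (rule that[of "Inl -` M" "Inr -` M"])
    show "good (Inl -` M) (Inr -` M)" using M by (simp add: F_def)
    fix E' p' assume *: "good E' p'" "Inl -` M \<subseteq> E'" "Inr -` M \<subseteq> p'"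
    have "M \<subseteq> Inl ` E' \<union> Inr ` p'"
    proof
      fix x assume "x \<in> M"
      then show "x \<in> Inl ` E' \<union> Inr ` p'" using *(2,3) by (cases x) auto
    qed
    moreover have eq: "Inl -` (Inl ` E' \<union> Inr ` p') = E'" "Inr -` (Inl ` E' \<union> Inr ` p') = p'" by auto
    then have "Inl ` E' \<union> Inr ` p' \<in> F" using *(1) by (simp add: F_def)
    ultimately have "Inl ` E' \<union> Inr ` p' = M" using M(2) by blast
    then show "E' = Inl -` M \<and> p' = Inr -` M" using eq by simp
  qed
qed

section \<open>Properties of a maximal pair\<close>

context
  fixes E p
  assumes good: "good E p"
    and maxi: "\<And>E' p'. good E' p' \<Longrightarrow> E \<subseteq> E' \<Longrightarrow> p \<subseteq> p' \<Longrightarrow> E' = E \<and> p' = p"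
begin

lemma E: "is_subring E" and DE: "D \<subseteq> E" and p: "is_ideal E p" and qp: "q \<subseteq> p"
  and pU: "\<And>j n. j \<in> p2 p \<Longrightarrow> n \<in> I \<Longrightarrow> j + n \<notin> U"
  using good by (auto simp: good_def)

lemma U_E: "U \<subseteq> p2 E"
  using poly_set_mono[OF poly_set_mono[OF DE]] by (auto simp: U_def)

text \<open>If \<open>a\<close> and \<open>b\<close> are outside \<open>p\<close>, maximality makes
  both \<open>p + a E\<close> and \<open>p + b E\<close> meet \<open>U\<close> modulo
  \<open>I\<close>. With \<open>a * b\<close> in \<open>p\<close>, the product of the two relations
  puts an element of \<open>U\<close> into \<open>p[X,Y] + I\<close>.\<close>

lemma maximal_prime: "is_prime E p"
proof -
  note S = p2_subring[OF E] and P = p2_ideal[OF E E p]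
  have zp: "0 \<in> p" and zE: "0 \<in> E" using ideal_zero[OF E p] subring_zero[OF E] .
  have "1 \<notin> p"
  proof
    assume "1 \<in> p"
    then have "1 \<in> p2 p" using zp by (simp add: one_pCons pCons_in_poly_set zero_in_poly_set)
    then show False using pU[of 1 0] one_in_U ideal_zero[OF UNIV I] by simp
  qed
  moreover have "a \<in> p \<or> b \<in> p" if ab: "a \<in> E" "b \<in> E" "a * b \<in> p" for a b
  proof (rule ccontr)
    assume *: "\<not> ?thesis"
    have meet: "\<exists>j e n. j \<in> p2 p \<and> e \<in> p2 E \<and> n \<in> I \<and> j + [:[:c:]:] * e + n \<in> U"
      if c: "c \<in> E" "c \<notin> p" for c
    proof -
      let ?P = "ideal_plus c E p"
      have "x + c * 0 \<in> ?P" if "x \<in> p" for x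
        unfolding ideal_plus_def using that zE by blast
      then have sub: "p \<subseteq> ?P" by auto
      have "0 + c * 1 \<in> ?P" unfolding ideal_plus_def using zp subring_one[OF E] by blast
      then have "?P \<noteq> p" using c by auto
      then have "\<not> good E ?P" using maxi[of E ?P] sub by auto
      then obtain j n where jn: "j \<in> p2 ?P" "n \<in> I" "j + n \<in> U"
        using is_ideal_ideal_plus[OF E p c(1)] sub E DE qp by (auto simp: good_def)
      have "p2 ?P \<subseteq> poly_set (ideal_plus [:c:] (poly_set E) (poly_set p))"
        by (intro poly_set_mono poly_set_ideal_plus zp zE)
      also have "\<dots> \<subseteq> ideal_plus [:[:c:]:] (p2 E) (p2 p)"
        by (intro poly_set_ideal_plus) (simp_all add: zero_in_poly_set zp zE)
      finally show ?thesis using jn unfolding ideal_plus_def by blast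
    qed
    obtain j e n where 1: "j \<in> p2 p" "e \<in> p2 E" "n \<in> I" "j + [:[:a:]:] * e + n \<in> U"
      using meet[of a] ab * by auto
    obtain k f m where 2: "k \<in> p2 p" "f \<in> p2 E" "m \<in> I" "k + [:[:b:]:] * f + m \<in> U"
      using meet[of b] ab * by auto
    have cns: "[:[:a:]:] \<in> p2 E" "[:[:b:]:] \<in> p2 E" "[:[:a * b:]:] \<in> p2 p"
      using ab zp zE by (simp_all add: pCons_in_poly_set zero_in_poly_set)
    define x where "x = j * (k + [:[:b:]:] * f) + [:[:a:]:] * e * k + [:[:a * b:]:] * (e * f)"
    \<comment> \<open>\<open>y\<close> collects the terms of the product that contain
      \<open>n\<close> or \<open>m\<close>; \<open>x\<close> collects the rest.\<close>
    define y where "y = n * (k + [:[:b:]:] * f + m) + (j + [:[:a:]:] * e) * m"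
    have "x \<in> p2 p"
      unfolding x_def using 1 2 cns ideal_mem[OF S P]
      by (intro ideal_add[OF S P] ideal_mult2[OF S P] ideal_mult[OF S P] subring_closed[OF S]) auto
    moreover have "y \<in> I"
      unfolding y_def using 1 2
      by (intro ideal_add[OF UNIV I] ideal_mult[OF UNIV I] ideal_mult2[OF UNIV I]) auto
    moreover have "(j + [:[:a:]:] * e + n) * (k + [:[:b:]:] * f + m) = x + y"
    proof -
      have "[:[:a * b:]:] = [:[:a:]:] * [:[:b:]:]" by simp
      then show ?thesis unfolding x_def y_def by (simp only: algebra_simps)
    qed
    ultimately show False using U_mult[OF 1(4) 2(4)] pU by metis
  qed
  ultimately show ?thesis using p by (auto simp: is_prime_def)
qed

text \<open>If neither element were in \<open>E\<close>, adjoining either would give a strictly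
  larger pair, which is not good; \<open>not_both_meet\<close> excludes that both fail.\<close>

lemma maximal_valuation:
  assumes "t \<noteq> 0"
  shows "t \<in> E \<or> inverse t \<in> E"
proof (rule ccontr)
  assume *: "\<not> ?thesis"
  note S = p2_subring[OF E] and P = p2_ideal[OF E E p]
  have meet: "\<exists>j\<in>adjoin [:[:s:]:] (p2 p). \<exists>n\<in>I. j + n \<in> U" if s: "s \<notin> E" for s
  proof -
    have sub: "E \<subseteq> adjoin s E" "p \<subseteq> adjoin s p"
      using subring_zero[OF E] ideal_zero[OF E p] by (simp_all add: subset_adjoin)
    have "adjoin s E \<noteq> E" using s in_adjoin[OF E] by auto
    then have "\<not> good (adjoin s E) (adjoin s p)" using maxi sub by blast
    then obtain j n where jn: "j \<in> p2 (adjoin s p)" "n \<in> I" "j + n \<in> U"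
      using is_subring_adjoin[OF E] is_ideal_adjoin[OF E p] sub DE qp by (auto simp: good_def)
    have "p2 (adjoin s p) \<subseteq> poly_set (adjoin [:s:] (poly_set p))"
      by (intro poly_set_mono poly_set_adjoin[OF E p])
    also have "\<dots> \<subseteq> adjoin [:[:s:]:] (p2 p)"
      by (rule poly_set_adjoin[OF is_subring_poly_set[OF E] is_ideal_poly_set[OF E p]])
    finally show ?thesis using jn by blast
  qed
  obtain f n where 1: "f \<in> adjoin [:[:t:]:] (p2 p)" "n \<in> I" "f + n \<in> U" using meet[of t] * by auto
  obtain f' n' where 2: "f' \<in> adjoin [:[:inverse t:]:] (p2 p)" "n' \<in> I" "f' + n' \<in> U"
    using meet[of "inverse t"] * by auto
  have "[:[:t:]:] * [:[:inverse t:]:] = (1 :: 'k poly poly)" using assms by (simp add: one_pCons)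
  then show False using not_both_meet[OF S P I U_E U_mult pU _ 1 2] by blast
qed

text \<open>Constants from \<open>E\<close> are algebraic by \<open>alg_q\<close>, the variables lie
  in \<open>D[X,Y]\<close>, and sums and products of algebraic elements are algebraic.\<close>

lemma maximal_alg:
  assumes "f \<in> p2 E"
  shows "prime_over.alg (p2 D) (p2 E) (p2 p) f"
proof -
  interpret prime_over "p2 D" "p2 E" "p2 p"
    using p2_subring[OF D] p2_subring[OF E] poly_set_mono[OF poly_set_mono[OF DE]]
      p2_prime[OF E E maximal_prime] by unfold_locales
  have D0: "0 \<in> D" "1 \<in> D" and E0: "0 \<in> E" using subring_zero[OF D] subring_one[OF D] subring_zero[OF E] .
  have cst: "[:[:c:]:] \<in> p2 A \<longleftrightarrow> c \<in> A" if "0 \<in> A" for c A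
    using that by (auto simp: pCons_in_poly_set zero_in_poly_set)
  have "[:[:0, 1:]:] \<in> p2 D" "[:0, 1:] \<in> p2 D"
    using D0 by (simp_all add: pCons_in_poly_set zero_in_poly_set one_pCons)
  then have X: "alg [:[:0, 1:]:]" and Y: "alg [:0, 1:]" by (blast intro: alg_base)+
  have const: "alg [:[:t:]:]" if "t \<in> E" for t
  proof -
    obtain g where g: "g \<in> poly_set D" "g \<notin> poly_set q" "poly g t = 0" using alg_q by blast
    then obtain i where i: "coeff g i \<notin> q" by (auto simp: poly_set_def)
    have gD: "coeff g i \<in> D" for i using g(1) by (auto simp: poly_set_def)
    \<comment> \<open>Such a \<open>c\<close>, as a constant polynomial, belongs to
      \<open>U\<close>. Hence the relation for \<open>t\<close> stays nontrivial modulo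
      \<open>p\<close>.\<close>
    have D_q: "c \<notin> p" if "c \<in> D" "c \<notin> q" for c
    proof
      assume "c \<in> p"
      then have "[:[:c:]:] + 0 \<notin> U"
        using ideal_zero[OF E p] ideal_zero[OF UNIV I] by (intro pU) (simp add: cst)
      then show False
        using that D0 ideal_zero[OF D is_prime_ideal[OF q]] by (simp add: U_def cst)
    qed
    have "q \<subseteq> D" using is_prime_ideal[OF q] by (auto simp: is_ideal_def)
    have "i \<le> degree g" using i ideal_zero[OF D is_prime_ideal[OF q]] by (metis le_degree)
    have "(\<Sum>i\<le>degree g. [:[:coeff g i:]:] * [:[:t:]:] ^ i) = [:[:poly g t:]:]"
    proof -
      have pow: "[:[:t:]:] ^ i = [:[:t ^ i:]:]" for i
        by (induction i) (simp_all add: one_pCons)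
      have sum: "(\<Sum>i\<le>n. [:[:f i:]:]) = [:[:\<Sum>i\<le>n. f i:]:]" for f :: "nat \<Rightarrow> 'k" and n
        by (induction n) simp_all
      have "(\<Sum>i\<le>degree g. [:[:coeff g i:]:] * [:[:t:]:] ^ i) = (\<Sum>i\<le>degree g. [:[:coeff g i * t ^ i:]:])"
        by (simp add: pow)
      then show ?thesis unfolding sum poly_altdef .
    qed
    then have "(\<Sum>i\<le>degree g. [:[:coeff g i:]:] * [:[:t:]:] ^ i) \<in> p2 p"
      using g(3) J_zero by simp
    moreover have "[:[:coeff g i:]:] \<notin> p2 p"
      using D_q[OF gD i] ideal_zero[OF E p] by (simp add: cst)
    ultimately show ?thesis
      using that gD D0 E0 \<open>i \<le> degree g\<close>
      by (intro algI[of _ "\<lambda>i. [:[:coeff g i:]:]" "degree g"]) (auto simp: cst)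
  qed
  have const2: "alg [:g:]" if "g \<in> poly_set E" for g
    using that
  proof (induction g rule: poly_set_induct)
    case zero
    show ?case using alg_base[OF LI(4)] by simp
  next
    case (pCons a g)
    have "[:pCons a g:] = [:[:a:]:] + [:[:0, 1:]:] * [:g:]" by simp
    then show ?case using alg_add[OF const alg_mult[OF X]] pCons by metis
  qed
  show "alg f"
    using assms
  proof (induction f rule: poly_set_induct)
    case zero
    show ?case using alg_base[OF LI(4)] by simp
  next
    case (pCons a g)
    have "pCons a g = [:a:] + [:0, 1:] * g" by simp
    then show ?case using alg_add[OF const2 alg_mult[OF Y]] pCons by metis
  qed
qed

lemma maximal_imp_I_zero: "I \<subseteq> {0}"
proof (rule ccontr)
  assume "\<not> ?thesis"
  then obtain F where F: "F \<in> I" "F \<noteq> 0" by auto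
  interpret prime_over "p2 D" "p2 E" "p2 p"
    using p2_subring[OF D] p2_subring[OF E] poly_set_mono[OF poly_set_mono[OF DE]]
      p2_prime[OF E E maximal_prime] by unfold_locales
  have "coeff (coeff F (degree F)) (degree (coeff F (degree F))) \<noteq> 0"
    using F(2) by simp
  then have "coeffs2 F - {0} \<noteq> {}" unfolding coeffs2_def by blast
  then obtain c where c: "c \<in> coeffs2 F" "c \<noteq> 0" "\<forall>x\<in>coeffs2 F - {0}. x / c \<in> E"
    using exists_dividing_coeff[of "coeffs2 F - {0}" E] finite_coeffs2 E maximal_valuation by auto
  \<comment> \<open>Dividing by the coefficient of least value brings \<open>F\<close> into
    \<open>E[X,Y]\<close> and makes one coefficient 1, so that \<open>G\<close> is not in
    \<open>p[X,Y]\<close>.\<close>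
  define G where "G = [:[:inverse c:]:] * F"
  have coeff_G: "coeff (coeff G i) j = coeff (coeff F i) j / c" for i j
    by (simp add: G_def divide_inverse mult.commute)
  have "coeff (coeff G i) j \<in> E" for i j
    using c(3) subring_zero[OF E] unfolding coeff_G coeffs2_def
    by (cases "coeff (coeff F i) j = 0") auto
  then have G: "G \<in> p2 E" by (auto simp: poly_set_def)
  have "G \<notin> p2 p"
  proof
    obtain i j where "c = coeff (coeff F i) j" using c(1) by (auto simp: coeffs2_def)
    then have "coeff (coeff G i) j = 1" using c(2) by (simp add: coeff_G)
    moreover assume "G \<in> p2 p"
    ultimately show False using maximal_prime by (auto simp: poly_set_def is_prime_def) metis
  qed
  then obtain e u where eu: "e \<in> p2 E" "u \<in> p2 D" "u \<notin> p2 p" "u - e * G \<in> p2 p"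
    using alg_multiple[OF maximal_alg[OF G]] by blast
  have "e * G \<in> I" unfolding G_def using F by (intro ideal_mult[OF UNIV I]) auto
  \<comment> \<open>This sum is \<open>u\<close> itself, written as an element of
    \<open>p[X,Y]\<close> plus one of \<open>I\<close>.\<close>
  then have "(u - e * G) + e * G \<notin> U" using eu(4) by (intro pU)
  moreover have "u \<in> U" using eu poly_set_mono[OF poly_set_mono[OF qp]] by (auto simp: U_def)
  ultimately show False by simp
qed

end

theorem I_zero: "I \<subseteq> {0}"
  using ex_maximal_good maximal_imp_I_zero by metis

end

subsection \<open>The height-one primes of \<open>D + X L[X]\<close>\<close>

lemma common_denominator:
  assumes "finite A" "T \<noteq> {}" "T \<subseteq> D" and D: "is_subring D"
    and mult: "\<And>s t. s \<in> T \<Longrightarrow> t \<in> T \<Longrightarrow> s * t \<in> T" and den: "\<And>x. x \<in> A \<Longrightarrow> \<exists>s\<in>T. s * x \<in> D"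
  shows "\<exists>s\<in>T. \<forall>x\<in>A. s * x \<in> D"
  using assms(1) den
proof (induction A rule: finite_induct)
  case empty
  then show ?case using assms(2) by auto
next
  case (insert y A)
  obtain s where "s \<in> T" "\<forall>x\<in>A. s * x \<in> D" using insert by auto
  moreover obtain t where "t \<in> T" "t * y \<in> D" using insert.prems by blast
  ultimately have st: "s \<in> T" "\<forall>x\<in>A. s * x \<in> D" "t \<in> T" "t * y \<in> D" by auto
  have "s * t * x \<in> D" if "x \<in> insert y A" for x
  proof (cases "x = y")
    case True
    then show ?thesis using st subring_mult[OF D, of s "t * y"] assms(3) by (auto simp: mult_ac)
  next
    case False
    then have "t \<in> D" "s * x \<in> D" using that st assms(3) by auto
    then have "t * (s * x) \<in> D" by (rule subring_mult[OF D])
    then show ?thesis by (simp add: mult_ac)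
  qed
  then show ?case using mult st by blast
qed

text \<open>\<open>L\<close> stands for \<open>D\<^sub>S\<close>: \<open>S_inv\<close> and
  \<open>L_den\<close> say that its denominators come from \<open>S\<close>. \<open>K_den\<close>
  makes the ambient field the fraction field of \<open>D\<close>.\<close>

locale D_plus_XL =
  fixes D L S :: "'k::field set"
  assumes D: "is_subring D" and L: "is_subring L" and D_L: "D \<subseteq> L"
    and S_D: "S \<subseteq> D" and S_ne: "S \<noteq> {}" and S_0: "0 \<notin> S"
    and S_mult: "\<And>s t. s \<in> S \<Longrightarrow> t \<in> S \<Longrightarrow> s * t \<in> S"
    and S_inv: "\<And>s. s \<in> S \<Longrightarrow> inverse s \<in> L"
    and L_den: "\<And>x. x \<in> L \<Longrightarrow> \<exists>s\<in>S. s * x \<in> D"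
    and K_den: "\<And>x. \<exists>d\<in>D. d \<noteq> 0 \<and> d * x \<in> D"
begin

definition "R = {f. coeff f 0 \<in> D \<and> (\<forall>i\<ge>1. coeff f i \<in> L)}"

lemma R_L: "f \<in> R \<Longrightarrow> f \<in> poly_set L"
  using D_L by (auto simp: R_def poly_set_def) (metis One_nat_def Suc_leI neq0_conv subsetD)

lemma R_iff: "f \<in> R \<longleftrightarrow> f \<in> poly_set L \<and> coeff f 0 \<in> D"
  using R_L by (auto simp: R_def poly_set_def)

lemma D_R: "poly_set D \<subseteq> R"
  using D_L by (auto simp: R_def poly_set_def)

lemma R: "is_subring R"
proof -
  note SL = is_subring_poly_set[OF L]
  have "coeff (f * g) 0 = coeff f 0 * coeff g 0" for f g :: "'k poly"
    by (simp add: coeff_mult)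
  then show ?thesis
    unfolding is_subring_def using subring_closed[OF SL] subring_closed[OF D]
    by (auto simp: R_iff)
qed

lemma const_R: "[:c:] \<in> R \<longleftrightarrow> c \<in> D"
  using D_L subring_zero[OF L] by (auto simp: R_iff pCons_in_poly_set zero_in_poly_set)

lemma X_R: "[:0, 1:] \<in> R"
  using subring_zero[OF L] subring_one[OF L] subring_zero[OF D]
  by (auto simp: R_iff pCons_in_poly_set zero_in_poly_set)

lemma clear_L:
  assumes "f \<in> R"
  shows "\<exists>s\<in>S. smult s f \<in> poly_set D"
proof -
  have "\<exists>s\<in>S. \<forall>x\<in>range (coeff f). s * x \<in> D"
    using R_L[OF assms] L_den
    by (intro common_denominator[OF finite_range_coeff S_ne S_D D S_mult]) (auto simp: poly_set_def)
  then show ?thesis by (auto simp: poly_set_def)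
qed

lemma clear_finite:
  assumes "finite A"
  shows "\<exists>d\<in>D. d \<noteq> 0 \<and> (\<forall>x\<in>A. d * x \<in> D)"
proof -
  have "\<exists>d\<in>D - {0}. \<forall>x\<in>A. d * x \<in> D"
  proof (rule common_denominator[OF assms _ _ D])
    show "D - {0} \<noteq> {}" using subring_one[OF D] by auto
    show "\<exists>s\<in>D - {0}. s * x \<in> D" for x using K_den[of x] by auto
  qed (auto intro: subring_mult[OF D])
  then show ?thesis by auto
qed

lemma clear_poly2:
  obtains d where "d \<in> D" "d \<noteq> 0" "[:[:d:]:] * f \<in> poly_set (poly_set D)"
proof -
  obtain d where "d \<in> D" "d \<noteq> 0" "\<forall>x\<in>coeffs2 f. d * x \<in> D"
    using clear_finite[OF finite_coeffs2[of f]] by auto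
  then show ?thesis
    by (intro that[of d]) (auto simp: poly_set_def coeffs2_def)
qed

lemma D2_R: "poly_set (poly_set D) \<subseteq> poly_set R"
  by (intro poly_set_mono D_R)

section \<open>A prime \<open>N\<close> of \<open>R[Y]\<close> strictly inside
  \<open>P[Y]\<close>\<close>

context
  fixes P N
  assumes P: "is_prime R P"
    and P_min: "\<And>Q. is_prime R Q \<Longrightarrow> Q \<subset> P \<Longrightarrow> Q = {0}"
    and N: "is_prime (poly_set R) N" and N_P: "N \<subset> poly_set P"
begin

lemmas PI = ideal_closed[OF R is_prime_ideal[OF P]]
lemmas NI = ideal_closed[OF is_subring_poly_set[OF R] is_prime_ideal[OF N]]

lemma P_R: "f \<in> P \<Longrightarrow> f \<in> R"
  using P by (auto simp: is_prime_def is_ideal_def)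

lemma prime_P: "f * g \<in> P \<Longrightarrow> f \<in> R \<Longrightarrow> g \<in> R \<Longrightarrow> f \<in> P \<or> g \<in> P"
  using P by (auto simp: is_prime_def)

lemma prime_N: "f * g \<in> N \<Longrightarrow> f \<in> poly_set R \<Longrightarrow> g \<in> poly_set R \<Longrightarrow> f \<in> N \<or> g \<in> N"
  using N by (auto simp: is_prime_def)

lemma const_in_poly_set_R: "r \<in> R \<Longrightarrow> [:r:] \<in> poly_set R"
  by (simp add: pCons_in_poly_set zero_in_poly_set subring_zero[OF R])

text \<open>The contraction of \<open>N\<close> to \<open>R\<close> is a prime inside
  \<open>P\<close>. It cannot be \<open>P\<close>, since then \<open>N\<close> would contain
  \<open>P[Y]\<close>, so \<open>P_min\<close> makes it zero.\<close>

lemma const_in_N: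
  assumes "[:r:] \<in> N"
  shows "r = 0"
proof -
  define Q where "Q = {r. [:r:] \<in> N}"
  have QP: "Q \<subseteq> P"
    using N_P by (auto simp: Q_def pCons_in_poly_set)
  have "is_prime R Q"
    unfolding is_prime_def is_ideal_def
  proof (intro conjI ballI impI)
    show "Q \<subseteq> R" using QP P_R by auto
    show "0 \<in> Q" using NI(1) by (simp add: Q_def)
    show "1 \<notin> Q" using N by (simp add: Q_def is_prime_def one_pCons)
    fix x y assume "x \<in> Q" "y \<in> Q"
    then show "x + y \<in> Q" using NI(2)[of "[:x:]" "[:y:]"] by (simp add: Q_def)
  next
    fix c x assume "c \<in> R" "x \<in> Q"
    then show "c * x \<in> Q"
      using NI(3)[OF const_in_poly_set_R, of c "[:x:]"] by (simp add: Q_def mult.commute)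
  next
    fix x y assume "x \<in> R" "y \<in> R" "x * y \<in> Q"
    then show "x \<in> Q \<or> y \<in> Q"
      using prime_N[of "[:x:]" "[:y:]"] const_in_poly_set_R by (simp add: Q_def mult.commute)
  qed
  moreover have "Q \<noteq> P"
  proof
    assume eq: "Q = P"
    have "f \<in> N" if "f \<in> poly_set P" for f
      using that
    proof (induction f rule: poly_set_induct)
      case zero
      show ?case by (rule NI)
    next
      case (pCons a g)
      have "[:0, 1:] \<in> poly_set R"
        by (simp add: pCons_in_poly_set zero_in_poly_set subring_zero[OF R] subring_one[OF R])
      then have "[:a:] + [:0, 1:] * g \<in> N"
        using pCons eq by (intro NI) (auto simp: Q_def)
      then show ?case by simp
    qed
    then show False using N_P by auto
  qed
  ultimately have "Q = {0}" using P_min QP by auto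
  then show ?thesis using assms by (auto simp: Q_def)
qed

text \<open>If \<open>P \<inter> D = 0\<close>, an element \<open>p\<close> of minimal degree in \<open>P\<close> generates \<open>P\<close> over the fraction
  field. Since \<open>p \<notin> N\<close>, elements of \<open>N\<close> can be divided by \<open>p\<close> without leaving \<open>N\<close>.\<close>
lemma N_zero_if_no_const:
  assumes "P \<noteq> {0}" and no_const: "\<And>c. [:c:] \<in> P \<Longrightarrow> c = 0"
  shows "N = {0}"
proof (rule ccontr)
  assume "N \<noteq> {0}"
  then obtain f0 where f0: "f0 \<in> N \<and> f0 \<noteq> 0" using NI(1) by auto
  obtain p0 where p0: "p0 \<in> P \<and> p0 \<noteq> 0" using assms(1) PI(1) by auto
  define p where "p = arg_min degree (\<lambda>p. p \<in> P \<and> p \<noteq> 0)"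
  have p: "p \<in> P" "p \<noteq> 0" "\<And>h. h \<in> P \<Longrightarrow> h \<noteq> 0 \<Longrightarrow> degree p \<le> degree h"
    using arg_min_natI[of "\<lambda>p. p \<in> P \<and> p \<noteq> 0", OF p0] arg_min_nat_le[of "\<lambda>p. p \<in> P \<and> p \<noteq> 0"]
    unfolding p_def by auto
  have deg_p: "degree p > 0"
  proof (rule ccontr)
    assume "\<not> ?thesis"
    then obtain c where "p = [:c:]" by (auto elim: degree_eq_zeroE)
    then show False using p no_const by auto
  qed
  \<comment> \<open>Dividing by \<open>[:p:]\<close> lowers the degree in \<open>X\<close> of the
    leading coefficient in \<open>Y\<close>, so minimality of this degree ends the descent.\<close>
  define f where "f = arg_min (\<lambda>f. degree (lead_coeff f)) (\<lambda>f. f \<in> N \<and> f \<noteq> 0)"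
  have f: "f \<in> N" "f \<noteq> 0"
      "\<And>h. h \<in> N \<Longrightarrow> h \<noteq> 0 \<Longrightarrow> degree (lead_coeff f) \<le> degree (lead_coeff h)"
    using arg_min_natI[of "\<lambda>f. f \<in> N \<and> f \<noteq> 0", OF f0]
      arg_min_nat_le[of "\<lambda>f. f \<in> N \<and> f \<noteq> 0" _ "\<lambda>f. degree (lead_coeff f)"]
    unfolding f_def by auto
  \<comment> \<open>Division with remainder takes place over the field. With the denominators of the
    quotient cleared by \<open>d\<close>, the remainder lies in \<open>P\<close> and must vanish by
    minimality of \<open>degree p\<close>.\<close>
  have "p dvd h" if h: "h \<in> P" for h
  proof -
    obtain d where d: "d \<in> D" "d \<noteq> 0" "\<forall>x\<in>range (coeff (h div p)). d * x \<in> D"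
      using clear_finite[OF finite_range_coeff] by blast
    then have "smult d (h div p) \<in> R" "[:d:] \<in> R"
      using D_R by (auto simp: poly_set_def const_R)
    then have "[:d:] * h - smult d (h div p) * p \<in> P"
      using h p(1) by (intro PI)
    moreover have "[:d:] * h - smult d (h div p) * p = smult d (h - h div p * p)"
      by (simp add: smult_diff_right)
    ultimately have "smult d (h mod p) \<in> P" by (simp add: minus_div_mult_eq_mod)
    then have "h mod p = 0"
      using p(3)[of "smult d (h mod p)"] degree_mod_less[of p h] p(2) d(2) by force
    then show ?thesis by auto
  qed
  moreover have "coeff f j \<in> P" for j using f N_P by (auto simp: poly_set_def)
  ultimately have "[:p:] dvd f" unfolding const_poly_dvd_iff by blast
  then obtain g where g: "f = [:p:] * g" by (auto elim: dvdE)
  obtain d where d: "d \<in> D" "d \<noteq> 0" "[:[:d:]:] * g \<in> poly_set (poly_set D)"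
    by (rule clear_poly2)
  have "[:[:d:]:] \<in> poly_set R" using d by (intro const_in_poly_set_R) (simp add: const_R)
  then have "[:[:d:]:] * f \<in> N" using f by (intro NI)
  also have "[:[:d:]:] * f = [:p:] * ([:[:d:]:] * g)" unfolding g by (simp only: mult_ac)
  finally have "[:p:] * ([:[:d:]:] * g) \<in> N" .
  \<comment> \<open>\<open>[:p:]\<close> is outside \<open>N\<close> by \<open>const_in_N\<close>,
    so primeness passes to the cofactor.\<close>
  then have "[:[:d:]:] * g \<in> N"
    using prime_N[of "[:p:]" "[:[:d:]:] * g"] const_in_N[of p] p D2_R d(3) P_R const_in_poly_set_R
    by blast
  moreover have "[:[:d:]:] * g \<noteq> 0" using g f(2) d(2) by auto
  ultimately have "degree (lead_coeff f) \<le> degree (lead_coeff ([:[:d:]:] * g))" by (rule f(3))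
  also have "\<dots> = degree (lead_coeff g)"
    unfolding lead_coeff_mult using d(2) by simp
  also have "\<dots> < degree (lead_coeff f)"
    unfolding g lead_coeff_mult using g f(2) p(2) deg_p by (subst degree_mult_eq) auto
  finally show False by simp
qed

text \<open>If \<open>P\<close> contains a constant, then \<open>P = q L[X] \<inter> R\<close> for \<open>q = P \<inter> D\<close>. The polynomials in \<open>R\<close>
  that vanish at \<open>t\<close> form another nonzero prime, so height one forces one of them out of \<open>P\<close>.\<close>
lemma N_zero_if_const:
  assumes c0: "[:c0:] \<in> P" "c0 \<noteq> 0"
  shows "N = {0}"
proof -
  define q where "q = {c. [:c:] \<in> P}"
  have q_D: "q \<subseteq> D" using P_R const_R by (auto simp: q_def)
  have q: "is_prime D q"
    unfolding is_prime_def is_ideal_def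
  proof (intro conjI ballI impI)
    show "q \<subseteq> D" by (rule q_D)
    show "0 \<in> q" using PI(1) by (simp add: q_def)
    show "1 \<notin> q" using P by (simp add: q_def is_prime_def one_pCons)
    fix x y assume "x \<in> q" "y \<in> q"
    then show "x + y \<in> q" using PI(2)[of "[:x:]" "[:y:]"] by (simp add: q_def)
  next
    fix c x assume "c \<in> D" "x \<in> q"
    then show "c * x \<in> q" using PI(3)[of "[:c:]" "[:x:]"] by (simp add: q_def const_R mult.commute)
  next
    fix x y assume "x \<in> D" "y \<in> D" "x * y \<in> q"
    then show "x \<in> q \<or> y \<in> q" using prime_P[of "[:x:]" "[:y:]"] by (simp add: q_def const_R mult.commute)
  qed
  note qI = ideal_closed[OF D is_prime_ideal[OF q]]
  note pq = is_prime_poly_set[OF D q]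
  note pqI = ideal_closed[OF is_subring_poly_set[OF D] is_prime_ideal[OF pq]]
  have prime_eq: "Q = P" if "is_prime R Q" "Q \<subseteq> P" "f \<in> Q" "f \<noteq> 0" for Q f
    using that P_min[of Q] by auto
  have S_q: "s \<notin> q" if s: "s \<in> S" for s
  proof
    assume "s \<in> q"
    \<comment> \<open>This is the prime \<open>X L[X]\<close>. Its elements remain in
      \<open>R\<close> after division by \<open>s\<close>, so it lies in \<open>P\<close>; yet it
      does not contain the constant \<open>s\<close>.\<close>
    define Q where "Q = {f \<in> R. coeff f 0 = 0}"
    have c0: "coeff (f * g) 0 = coeff f 0 * coeff g 0" for f g :: "'k poly"
      by (simp add: coeff_mult)
    have "is_prime R Q"
      unfolding is_prime_def is_ideal_def using subring_closed[OF R]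
      by (auto simp: Q_def c0)
    moreover have "Q \<subseteq> P"
    proof
      fix f assume f: "f \<in> Q"
      then have "smult (inverse s) f \<in> R"
        using S_inv[OF s] subring_mult[OF L] subring_zero[OF D] R_L[of f]
        by (auto simp: Q_def R_def poly_set_def)
      then have "[:s:] * smult (inverse s) f \<in> P" using \<open>s \<in> q\<close> by (intro PI(4)) (auto simp: q_def)
      moreover have "s \<noteq> 0" using s S_0 by auto
      ultimately show "f \<in> P" by simp
    qed
    moreover have "[:0, 1:] \<in> Q" using X_R by (simp add: Q_def)
    ultimately have "Q = P" by (rule prime_eq) simp
    moreover have "[:s:] \<in> P" using \<open>s \<in> q\<close> by (simp add: q_def)
    ultimately show False using s S_0 by (auto simp: Q_def)
  qed
  have P_mem: "f \<in> P \<longleftrightarrow> f \<in> R \<and> (\<exists>s\<in>S. smult s f \<in> poly_set q)" for f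
  proof -
    \<comment> \<open>This is \<open>q L[X] \<inter> R\<close>. It is a prime inside
      \<open>P\<close> containing the nonzero constant \<open>c0\<close>, hence equal to
      \<open>P\<close>.\<close>
    define Q where "Q = {f \<in> R. \<exists>s\<in>S. smult s f \<in> poly_set q}"
    have q_P: "f \<in> P" if "f \<in> poly_set q" for f
      using that
    proof (induction f rule: poly_set_induct)
      case zero
      show ?case by (rule PI)
    next
      case (pCons a g)
      then have "[:a:] + [:0, 1:] * g \<in> P" using X_R by (intro PI) (auto simp: q_def)
      then show ?case by simp
    qed
    have "is_prime R Q"
      unfolding is_prime_def is_ideal_def
    proof (intro conjI ballI impI)
      show "Q \<subseteq> R" by (auto simp: Q_def)
      show "0 \<in> Q" using S_ne pqI(1) subring_zero[OF R] by (auto simp: Q_def)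
      show "1 \<notin> Q" using S_q by (auto simp: Q_def one_pCons pCons_in_poly_set)
    next
      fix f g assume fg: "f \<in> Q" "g \<in> Q"
      then obtain s t where st: "s \<in> S" "smult s f \<in> poly_set q" "t \<in> S" "smult t g \<in> poly_set q"
        by (auto simp: Q_def)
      have "[:t:] \<in> poly_set D" "[:s:] \<in> poly_set D"
        using st S_D subring_zero[OF D] by (auto simp: pCons_in_poly_set zero_in_poly_set)
      then have "[:t:] * smult s f + [:s:] * smult t g \<in> poly_set q"
        using st by (intro pqI)
      then have "smult (s * t) (f + g) \<in> poly_set q" by (simp add: smult_add_right mult.commute)
      then show "f + g \<in> Q" using fg st S_mult subring_add[OF R] by (auto simp: Q_def)
    next
      fix c f assume cf: "c \<in> R" "f \<in> Q"
      then obtain s where s: "s \<in> S" "smult s f \<in> poly_set q" by (auto simp: Q_def)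
      obtain t where t: "t \<in> S" "smult t c \<in> poly_set D" using clear_L[OF cf(1)] by auto
      then have "smult t c * smult s f \<in> poly_set q" using s by (intro pqI)
      then have "smult (t * s) (c * f) \<in> poly_set q" by (simp add: mult.commute)
      then show "c * f \<in> Q" using cf s t S_mult subring_mult[OF R] by (auto simp: Q_def)
    next
      fix f g assume fg: "f \<in> R" "g \<in> R" "f * g \<in> Q"
      then obtain s where s: "s \<in> S" "smult s (f * g) \<in> poly_set q" by (auto simp: Q_def)
      obtain t where t: "t \<in> S" "smult t f \<in> poly_set D" using clear_L[OF fg(1)] by auto
      obtain u where u: "u \<in> S" "smult u g \<in> poly_set D" using clear_L[OF fg(2)] by auto
      have S_pD: "[:s:] \<in> poly_set D" if "s \<in> S" for s
        using that S_D subring_zero[OF D] by (auto simp: pCons_in_poly_set zero_in_poly_set)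
      have "[:t:] * ([:u:] * smult s (f * g)) \<in> poly_set q"
        using s t u S_pD by (intro pqI)
      \<comment> \<open>Once \<open>t\<close> and \<open>u\<close> have cleared the factors,
        \<open>s\<close> can be cancelled because \<open>q[X]\<close> is prime and \<open>s\<close>
        is outside \<open>q\<close>.\<close>
      then have "[:s:] * (smult t f * smult u g) \<in> poly_set q" by (simp add: mult_ac)
      moreover have "[:s:] \<notin> poly_set q" using S_q[OF s(1)] by (simp add: pCons_in_poly_set)
      moreover have "smult t f * smult u g \<in> poly_set D"
        using t u by (intro subring_mult[OF is_subring_poly_set[OF D]])
      ultimately have "smult t f * smult u g \<in> poly_set q"
        using pq S_pD[OF s(1)] unfolding is_prime_def by blast
      then have "smult t f \<in> poly_set q \<or> smult u g \<in> poly_set q"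
        using pq t u unfolding is_prime_def by blast
      then show "f \<in> Q \<or> g \<in> Q" using fg t u by (auto simp: Q_def)
    qed
    moreover have "Q \<subseteq> P"
    proof
      fix f assume "f \<in> Q"
      then obtain s where s: "f \<in> R" "s \<in> S" "smult s f \<in> poly_set q" by (auto simp: Q_def)
      then have "[:s:] * f \<in> P" using q_P by simp
      moreover have "[:s:] \<notin> P" "[:s:] \<in> R" using S_q[OF s(2)] s(2) S_D by (auto simp: q_def const_R)
      ultimately show "f \<in> P" using prime_P s(1) by blast
    qed
    moreover have "[:c0:] \<in> Q"
    proof -
      obtain s where s: "s \<in> S" using S_ne by auto
      then have "s * c0 \<in> q" using c0 S_D qI(3) by (auto simp: q_def)
      then show ?thesis using s c0 P_R qI(1)
        by (auto simp: Q_def pCons_in_poly_set zero_in_poly_set)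
    qed
    ultimately have "Q = P" using c0 by (intro prime_eq) auto
    then show ?thesis by (auto simp: Q_def)
  qed
  have P_D: "f \<in> poly_set q" if f: "f \<in> P" "f \<in> poly_set D" for f
  proof -
    obtain s where s: "s \<in> S" "smult s f \<in> poly_set q" using P_mem[of f] f(1) by auto
    then have "s * coeff f i \<in> q" for i by (auto simp: poly_set_def)
    moreover have "s \<in> D" "coeff f i \<in> D" for i using s S_D f(2) by (auto simp: poly_set_def)
    ultimately have "coeff f i \<in> q" for i
      using S_q[OF s(1)] q unfolding is_prime_def by blast
    then show ?thesis by (auto simp: poly_set_def)
  qed
  have alg: "\<exists>g\<in>poly_set D. g \<notin> poly_set q \<and> poly g t = 0" for t
  proof -
    \<comment> \<open>This prime is nonzero, as it contains a linear polynomial with root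
      \<open>t\<close>, and it differs from \<open>P\<close>, as it omits \<open>c0\<close>. Hence
      it is not contained in \<open>P\<close>.\<close>
    define Q where "Q = {f \<in> R. poly f t = 0}"
    have "is_prime R Q"
      unfolding is_prime_def is_ideal_def using subring_closed[OF R] by (auto simp: Q_def)
    moreover obtain d where d: "d \<in> D" "d \<noteq> 0" "d * t \<in> D" using K_den by auto
    then have "[:- (d * t), d:] \<in> poly_set D"
      using subring_uminus[OF D] subring_zero[OF D] by (simp add: pCons_in_poly_set zero_in_poly_set)
    then have "[:- (d * t), d:] \<in> Q" using D_R by (auto simp: Q_def)
    ultimately have "Q = P" if "Q \<subseteq> P" using d(2) that by (intro prime_eq) auto
    moreover have "Q \<noteq> P" using c0 by (auto simp: Q_def)
    ultimately obtain g where g: "g \<in> R" "poly g t = 0" "g \<notin> P" by (auto simp: Q_def)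
    obtain s where "s \<in> S" "smult s g \<in> poly_set D" using clear_L[OF g(1)] by auto
    then show ?thesis using g P_mem by (intro bexI[of _ "smult s g"]) auto
  qed
  \<comment> \<open>The extension \<open>N K[X,Y]\<close>, written with a single
    denominator.\<close>
  define I where "I = {f. \<exists>d\<in>D. d \<noteq> 0 \<and> [:[:d:]:] * f \<in> N}"
  have cst: "[:[:d:]:] \<in> poly_set R" if "d \<in> D" for d
    using that by (intro const_in_poly_set_R) (simp add: const_R)
  interpret algebraic_residue D q I
  proof
    show "is_ideal UNIV I"
      unfolding is_ideal_def
    proof (intro conjI ballI)
      show "0 \<in> I" using subring_one[OF D] NI(1) by (auto simp: I_def intro!: bexI[of _ 1])
      fix x y assume "x \<in> I" "y \<in> I"
      then obtain d e where de: "d \<in> D" "d \<noteq> 0" "[:[:d:]:] * x \<in> N" "e \<in> D" "e \<noteq> 0" "[:[:e:]:] * y \<in> N"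
        by (auto simp: I_def)
      then have "[:[:e:]:] * ([:[:d:]:] * x) + [:[:d:]:] * ([:[:e:]:] * y) \<in> N"
        by (intro NI(2)[OF NI(3)[OF cst] NI(3)[OF cst]])
      moreover have "[:[:d * e:]:] * (x + y) = [:[:e:]:] * ([:[:d:]:] * x) + [:[:d:]:] * ([:[:e:]:] * y)"
        by (simp add: smult_add_right mult.commute)
      ultimately show "x + y \<in> I"
        using de subring_mult[OF D] by (auto simp: I_def simp del: mult_pCons_left intro!: bexI[of _ "d * e"])
    next
      fix c x assume "x \<in> I"
      then obtain d where d: "d \<in> D" "d \<noteq> 0" "[:[:d:]:] * x \<in> N" by (auto simp: I_def)
      obtain e where e: "e \<in> D" "e \<noteq> 0" "[:[:e:]:] * c \<in> poly_set (poly_set D)" by (rule clear_poly2)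
      then have "([:[:e:]:] * c) * ([:[:d:]:] * x) \<in> N" using d(3) D2_R NI(3) by blast
      moreover have "[:[:d * e:]:] * (c * x) = ([:[:e:]:] * c) * ([:[:d:]:] * x)"
        by (simp add: mult.commute)
      ultimately have "[:[:d * e:]:] * (c * x) \<in> N" by (simp only:)
      moreover have "d * e \<in> D" "d * e \<noteq> 0" using d e subring_mult[OF D] by auto
      ultimately show "c * x \<in> I" unfolding I_def by blast
    qed simp
    \<comment> \<open>The denominator is a nonzero constant, hence outside \<open>N\<close>, so
      \<open>u\<close> itself lies in \<open>N\<close> and thus in \<open>P[Y]\<close>;
      \<open>P_D\<close> then applies to its coefficients.\<close>
    show "u \<in> poly_set (poly_set q)" if u: "u \<in> I" "u \<in> poly_set (poly_set D)" for u
    proof -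
      obtain d where d: "d \<in> D" "d \<noteq> 0" "[:[:d:]:] * u \<in> N" using u by (auto simp: I_def)
      have "[:[:d:]:] \<notin> N" using const_in_N[of "[:d:]"] d(2) by auto
      then have "u \<in> N" using prime_N[OF d(3) cst[OF d(1)]] u(2) D2_R by auto
      then show ?thesis using N_P u(2) P_D by (auto simp: poly_set_def[of P] poly_set_def[of "poly_set _"])
    qed
  qed (fact D q alg)+
  have "N \<subseteq> I" using subring_one[OF D] by (auto simp: I_def intro!: bexI[of _ 1] simp flip: one_pCons)
  then show ?thesis using I_zero NI(1) by auto
qed

end

theorem no_prime_below_extension:
  assumes "is_prime R P" "P \<noteq> {0}" "\<And>Q. is_prime R Q \<Longrightarrow> Q \<subset> P \<Longrightarrow> Q = {0}"
    and "is_prime (poly_set R) N" "N \<subset> poly_set P"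
  shows "N = {0}"
  using N_zero_if_no_const[OF assms(1,3,4,5,2)] N_zero_if_const[OF assms(1,3,4,5)] by blast

end

subsection \<open>Transfer to the structures of \<open>HOL-Algebra\<close>\<close>

abbreviation ring_on :: "'t::comm_ring_1 set \<Rightarrow> 't ring" where
  "ring_on A \<equiv> ring_of_type_algebra\<lparr>carrier := A\<rparr>"

lemma ring_on_simps:
  "x \<otimes>\<^bsub>ring_of_type_algebra\<^esub> y = x * y" "x \<oplus>\<^bsub>ring_of_type_algebra\<^esub> y = x + y"
  "\<one>\<^bsub>ring_of_type_algebra\<^esub> = 1" "\<zero>\<^bsub>ring_of_type_algebra\<^esub> = 0"
  by (simp_all add: ring_of_type_algebra_def)

lemma cring_ring_on:
  assumes "is_subring A"
  shows "cring (ring_on A)"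
proof (rule cringI)
  have "\<exists>y\<in>A. y + x = 0" if "x \<in> A" for x
    using subring_uminus[OF assms that] by (intro bexI[of _ "- x"]) auto
  then show "abelian_group (ring_on A)"
    using subring_closed[OF assms]
    by (intro abelian_groupI) (auto simp: ring_on_simps algebra_simps)
  show "comm_monoid (ring_on A)"
    using subring_closed[OF assms]
    by (intro comm_monoidI) (auto simp: ring_on_simps algebra_simps)
qed (simp add: ring_on_simps algebra_simps)

lemma domain_ring_on:
  fixes A :: "'t::idom set"
  assumes "is_subring A"
  shows "domain (ring_on A)"
  using cring_ring_on[OF assms] by (auto intro!: domain.intro domain_axioms.intro simp: ring_on_simps)

text \<open>Brings the library notion into the shape of \<open>is_prime\<close>; closure under
  negation comes from multiplying by the negative of the unit.\<close>

lemma primeideal_iff: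
  fixes R (structure)
  assumes "cring R"
  shows "primeideal P R \<longleftrightarrow> P \<subseteq> carrier R \<and> \<zero> \<in> P \<and> (\<forall>x\<in>P. \<forall>y\<in>P. x \<oplus> y \<in> P) \<and>
    (\<forall>c\<in>carrier R. \<forall>x\<in>P. c \<otimes> x \<in> P) \<and> \<one> \<notin> P \<and>
    (\<forall>x\<in>carrier R. \<forall>y\<in>carrier R. x \<otimes> y \<in> P \<longrightarrow> x \<in> P \<or> y \<in> P)"
proof -
  interpret cring R by fact
  show ?thesis
  proof (intro iffI conjI ballI impI)
    assume "primeideal P R"
    then interpret primeideal P R .
    show "P \<subseteq> carrier R" by (rule a_subset)
    show "\<zero> \<in> P" by (rule zero_closed)
    show "\<one> \<notin> P" using one_imp_carrier I_notcarr by auto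
    show "x \<oplus> y \<in> P" if "x \<in> P" "y \<in> P" for x y using that by (rule a_closed)
    show "c \<otimes> x \<in> P" if "c \<in> carrier R" "x \<in> P" for c x using that by (intro I_l_closed)
    show "x \<in> P \<or> y \<in> P" if "x \<in> carrier R" "y \<in> carrier R" "x \<otimes> y \<in> P" for x y
      using that by (rule I_prime)
  next
    assume *: "P \<subseteq> carrier R \<and> \<zero> \<in> P \<and> (\<forall>x\<in>P. \<forall>y\<in>P. x \<oplus> y \<in> P) \<and>
      (\<forall>c\<in>carrier R. \<forall>x\<in>P. c \<otimes> x \<in> P) \<and> \<one> \<notin> P \<and>
      (\<forall>x\<in>carrier R. \<forall>y\<in>carrier R. x \<otimes> y \<in> P \<longrightarrow> x \<in> P \<or> y \<in> P)"
    have "\<ominus> x \<in> P" if "x \<in> P" for x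
    proof -
      have "(\<ominus> \<one>) \<otimes> x \<in> P" using * that by auto
      moreover have "(\<ominus> \<one>) \<otimes> x = \<ominus> x" using * that by (auto simp: l_minus)
      ultimately show ?thesis by simp
    qed
    then have "additive_subgroup P R"
      using * by (intro additive_subgroup.intro subgroup.intro)
        (auto simp: a_inv_def[symmetric])
    moreover have "a \<otimes> c \<in> P" if "a \<in> P" "c \<in> carrier R" for a c
      using that * m_comm[of a c] by auto
    ultimately show "primeideal P R"
      using * by (intro primeidealI2) (auto simp: is_cring)
  qed
qed

lemma primeideal_ring_on:
  "is_subring A \<Longrightarrow> primeideal P (ring_on A) \<longleftrightarrow> is_prime A P"
  by (simp add: primeideal_iff[OF cring_ring_on] ring_on_simps is_prime_def is_ideal_def)

text \<open>The library represents polynomials as coefficient functions, so \<open>coeff\<close> is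
  the identification with the type \<open>poly\<close>.\<close>

lemma up_ring_on:
  assumes "0 \<in> A"
  shows "up (ring_on A) = coeff ` poly_set A"
proof (intro equalityI subsetI)
  fix f assume "f \<in> up (ring_on A)"
  then obtain n where f: "\<And>i. f i \<in> A" "\<And>i. n < i \<Longrightarrow> f i = 0"
    by (auto simp: up_def ring_on_simps bound_def)
  then have "coeff (Abs_poly f) = f" by (intro coeff_Abs_poly) auto
  then show "f \<in> coeff ` poly_set A"
    using f(1) by (intro image_eqI[of _ _ "Abs_poly f"]) (auto simp: poly_set_def)
next
  fix f assume "f \<in> coeff ` poly_set A"
  then obtain g where "f = coeff g" "g \<in> poly_set A" by auto
  then show "f \<in> up (ring_on A)"
    by (auto simp: up_def ring_on_simps poly_set_def bound_def intro!: exI[of _ "degree g"] coeff_eq_0)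
qed

lemma finsum_ring_on:
  assumes "is_subring A" "finite T" "\<And>i. i \<in> T \<Longrightarrow> f i \<in> A"
  shows "finsum (ring_on A) f T = sum f T"
proof -
  interpret cring "ring_on A" using assms(1) by (rule cring_ring_on)
  show ?thesis
    using assms(2,3)
    by (induction T rule: finite_induct) (simp_all add: ring_on_simps Pi_def)
qed

lemma UP_ring_on_simps:
  assumes "is_subring A"
  shows "carrier (UP (ring_on A)) = coeff ` poly_set A"
    and "f \<in> poly_set A \<Longrightarrow> g \<in> poly_set A \<Longrightarrow> coeff f \<otimes>\<^bsub>UP (ring_on A)\<^esub> coeff g = coeff (f * g)"
    and "f \<in> poly_set A \<Longrightarrow> g \<in> poly_set A \<Longrightarrow> coeff f \<oplus>\<^bsub>UP (ring_on A)\<^esub> coeff g = coeff (f + g)"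
    and "\<one>\<^bsub>UP (ring_on A)\<^esub> = coeff 1" "\<zero>\<^bsub>UP (ring_on A)\<^esub> = coeff 0"
proof -
  note up = up_ring_on[OF subring_zero[OF assms]]
  show "carrier (UP (ring_on A)) = coeff ` poly_set A" by (simp add: UP_def up)
  show "coeff f \<oplus>\<^bsub>UP (ring_on A)\<^esub> coeff g = coeff (f + g)"
    if "f \<in> poly_set A" "g \<in> poly_set A"
    using that by (auto simp: UP_def up ring_on_simps)
  show "coeff f \<otimes>\<^bsub>UP (ring_on A)\<^esub> coeff g = coeff (f * g)"
    if "f \<in> poly_set A" "g \<in> poly_set A"
  proof
    fix n
    have "coeff f i * coeff g (n - i) \<in> A" for i
      using that subring_mult[OF assms] by (auto simp: poly_set_def)
    then show "(coeff f \<otimes>\<^bsub>UP (ring_on A)\<^esub> coeff g) n = coeff (f * g) n"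
      using that by (simp add: UP_def up ring_on_simps coeff_mult finsum_ring_on[OF assms])
  qed
  show "\<one>\<^bsub>UP (ring_on A)\<^esub> = coeff 1" "\<zero>\<^bsub>UP (ring_on A)\<^esub> = coeff 0"
    by (auto simp: UP_def ring_on_simps coeff_1)
qed

text \<open>\<open>coeff\<close> is injective and respects the operations, so primes correspond to
  their images.\<close>

lemma primeideal_UP_ring_on:
  assumes "is_subring A"
  shows "primeideal P (UP (ring_on A)) \<longleftrightarrow> (\<exists>M. P = coeff ` M \<and> is_prime (poly_set A) M)"
proof -
  have UP_cring: "cring (UP (ring_on A))"
    by (rule UP_cring.UP_cring[OF UP_cring.intro[OF cring_ring_on[OF assms]]])
  note simps = UP_ring_on_simps[OF assms]
  note S = is_subring_poly_set[OF assms]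
  have mem: "coeff f \<in> coeff ` M \<longleftrightarrow> f \<in> M" for f :: "'a poly" and M
    by (auto simp: coeff_inject)
  have iff: "primeideal (coeff ` M) (UP (ring_on A)) \<longleftrightarrow> is_prime (poly_set A) M" for M
  proof (cases "M \<subseteq> poly_set A")
    case True
    then have "f \<in> poly_set A" if "f \<in> M" for f using that by auto
    then show ?thesis
      using True
      by (auto simp: primeideal_iff[OF UP_cring] is_prime_def is_ideal_def simps mem)
  next
    case False
    then have "\<not> coeff ` M \<subseteq> coeff ` poly_set A" using mem by blast
    then show ?thesis
      using False by (simp add: primeideal_iff[OF UP_cring] is_prime_def is_ideal_def simps)
  qed
  show ?thesis
  proof
    assume P: "primeideal P (UP (ring_on A))"
    then have "P \<subseteq> coeff ` poly_set A" by (simp add: primeideal_iff[OF UP_cring] simps)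
    then obtain M where "P = coeff ` M" by (auto simp: subset_image_iff)
    then show "\<exists>M. P = coeff ` M \<and> is_prime (poly_set A) M" using P iff by blast
  qed (use iff in blast)
qed

text \<open>In a domain the zero ideal is prime and lies in every prime. Height one thus means being
  minimal among the nonzero primes.\<close>

lemma prime_height_eq_1_iff:
  fixes R (structure)
  assumes R: "domain R" and P: "primeideal P R"
  shows "prime_height R P = 1 \<longleftrightarrow> P \<noteq> {\<zero>} \<and> (\<forall>Q. primeideal Q R \<and> Q \<subset> P \<longrightarrow> Q = {\<zero>})"
proof -
  interpret domain R by fact
  have zero: "\<zero> \<in> Q" if "primeideal Q R" for Q
    using that by (simp add: primeideal_iff[OF is_cring])
  define H where "H = {n :: nat. \<exists>C. (\<forall>i\<le>n. primeideal (C i) R) \<and> (\<forall>i<n. C i \<subset> C (Suc i)) \<and> C n = P}"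
  have height: "prime_height R P = (SUP n\<in>H. enat n)" by (simp add: prime_height_def H_def)
  show ?thesis
  proof (intro iffI conjI allI impI)
    assume h: "prime_height R P = 1"
    show "P \<noteq> {\<zero>}"
    proof
      assume P0: "P = {\<zero>}"
      have "n = 0" if n: "n \<in> H" for n
      proof (rule ccontr)
        assume "n \<noteq> 0"
        then obtain m where m: "n = Suc m" by (cases n) auto
        obtain C where "\<forall>i\<le>n. primeideal (C i) R" "\<forall>i<n. C i \<subset> C (Suc i)" "C n = P"
          using n by (auto simp: H_def)
        then have "primeideal (C m) R" "C m \<subset> {\<zero>}" using m P0 by auto
        then show False using zero by blast
      qed
      then have "(SUP n\<in>H. enat n) \<le> 0" by (intro SUP_least) (auto simp: zero_enat_def)
      then show False using h height by simp
    qed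
    fix Q assume Q: "primeideal Q R \<and> Q \<subset> P"
    show "Q = {\<zero>}"
    proof (rule ccontr)
      assume "Q \<noteq> {\<zero>}"
      then have "{\<zero>} \<subset> Q" using zero Q by auto
      then have "2 \<in> H"
        using Q P zeroprimeideal unfolding H_def
        by (auto intro!: exI[of _ "\<lambda>i::nat. if i = 0 then {\<zero>} else if i = 1 then Q else P"]
            simp: less_Suc_eq numeral_2_eq_2)
      then have "enat 2 \<le> (SUP n\<in>H. enat n)" by (rule SUP_upper)
      then show False using h height by (simp add: one_enat_def)
    qed
  next
    assume *: "P \<noteq> {\<zero>} \<and> (\<forall>Q. primeideal Q R \<and> Q \<subset> P \<longrightarrow> Q = {\<zero>})"
    have "n \<le> 1" if n: "n \<in> H" for n
    proof (rule ccontr)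
      assume "\<not> n \<le> 1"
      then obtain m where m: "n = Suc (Suc m)" by (metis One_nat_def not0_implies_Suc not_less_eq_eq zero_le)
      obtain C where C: "\<forall>i\<le>n. primeideal (C i) R" "\<forall>i<n. C i \<subset> C (Suc i)" "C n = P"
        using n by (auto simp: H_def)
      have "primeideal (C (Suc m)) R" "C (Suc m) \<subset> P" using C m by auto
      \<comment> \<open>The next member \<open>C m\<close> would have to be strictly smaller than
        the zero ideal.\<close>
      then have "C (Suc m) = {\<zero>}" using * by auto
      moreover have "primeideal (C m) R" "C m \<subset> C (Suc m)" using C m by auto
      ultimately show False using zero[of "C m"] by auto
    qed
    then have "(SUP n\<in>H. enat n) \<le> 1" by (intro SUP_least) (auto simp: one_enat_def)
    moreover have "1 \<in> H"
      using * P zeroprimeideal zero unfolding H_def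
      by (auto intro!: exI[of _ "\<lambda>i::nat. if i = 0 then {\<zero>} else P"] simp: less_Suc_eq)
    then have "enat 1 \<le> (SUP n\<in>H. enat n)" by (rule SUP_upper)
    ultimately show "prime_height R P = 1" using height by (simp add: one_enat_def)
  qed
qed

lemma D_plus_XL_localization:
  fixes S :: "'a::idom set"
  assumes "S \<noteq> {}" and "0 \<notin> S" and mult: "\<And>s t. s \<in> S \<Longrightarrow> t \<in> S \<Longrightarrow> s * t \<in> S"
  shows "D_plus_XL (range (\<lambda>a. Fract a 1)) (localization S) ((\<lambda>a. Fract a 1) ` S)"
proof -
  let ?D = "range (\<lambda>a :: 'a. Fract a 1)"
  have nz: "s \<noteq> 0" if "s \<in> S" for s using that assms(2) by auto
  \<comment> \<open>\<open>S\<close> may fail to contain 1, so 1 is written as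
    \<open>s0 / s0\<close> and \<open>a\<close> as \<open>a s0 / s0\<close>.\<close>
  obtain s0 where s0: "s0 \<in> S" using assms(1) by auto
  have loc: "Fract a s \<in> localization S" if "s \<in> S" for a s
    using that by (auto simp: localization_def)
  show ?thesis
  proof
    show "is_subring ?D"
      unfolding is_subring_def by (auto simp: One_fract_def)
    have "Fract s0 s0 = 1" using s0 nz by (simp add: One_fract_def eq_fract)
    then have one: "1 \<in> localization S" using loc[OF s0, of s0] by simp
    show "is_subring (localization S)"
      unfolding is_subring_def
    proof (intro conjI ballI one)
      fix x y assume "x \<in> localization S" "y \<in> localization S"
      then obtain a s b t where "x = Fract a s" "s \<in> S" "y = Fract b t" "t \<in> S"
        by (auto simp: localization_def)
      then show "x - y \<in> localization S" "x * y \<in> localization S"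
        using nz mult by (auto intro: loc)
    qed
    show "?D \<subseteq> localization S"
    proof
      fix x assume "x \<in> ?D"
      then obtain a where "x = Fract a 1" by auto
      then have "x = Fract (a * s0) s0" using nz[OF s0] by (simp add: eq_fract)
      then show "x \<in> localization S" using loc[OF s0] by simp
    qed
    show "0 \<notin> (\<lambda>a. Fract a 1) ` S" using assms(2) by (auto simp: Zero_fract_def eq_fract)
    show "s * t \<in> (\<lambda>a. Fract a 1) ` S" if "s \<in> (\<lambda>a. Fract a 1) ` S" "t \<in> (\<lambda>a. Fract a 1) ` S" for s t
      using that mult by auto
    show "inverse s \<in> localization S" if "s \<in> (\<lambda>a. Fract a 1) ` S" for s
      using that loc by auto
    show "\<exists>s\<in>(\<lambda>a. Fract a 1) ` S. s * x \<in> ?D" if x: "x \<in> localization S" for x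
    proof -
      obtain a s where "x = Fract a s" "s \<in> S" using x by (auto simp: localization_def)
      then have "Fract s 1 * x = Fract a 1" using nz by (simp add: eq_fract)
      then show ?thesis using \<open>s \<in> S\<close> by auto
    qed
    show "\<exists>d\<in>?D. d \<noteq> 0 \<and> d * x \<in> ?D" for x
    proof -
      obtain a b where x: "x = Fract a b" "b \<noteq> 0" by (cases x) auto
      then have "Fract b 1 * x = Fract a 1" by (simp add: eq_fract)
      moreover have "Fract b 1 \<noteq> 0" using x by (simp add: Zero_fract_def eq_fract)
      ultimately show ?thesis by auto
    qed
  qed (use assms(1) in auto)
qed

theorem proposition2p11:
  fixes S :: "'a::idom set"
  assumes "S \<noteq> {}"
    and "0 \<notin> S"
    and "\<And>s t. s \<in> S \<Longrightarrow> t \<in> S \<Longrightarrow> s * t \<in> S"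
  shows "S_domain (D_plus_X_loc S)"
proof -
  interpret D_plus_XL "range (\<lambda>a. Fract a 1)" "localization S" "(\<lambda>a. Fract a 1) ` S"
    using assms by (rule D_plus_XL_localization)
  have eq: "D_plus_X_loc S = ring_on R"
    by (simp add: D_plus_X_loc_def R_def)
  note dom = domain_ring_on[OF R]
  have UP_domain: "domain (UP (ring_on R))"
    by (rule UP_domain.UP_domain[OF UP_domain.intro[OF dom]])
  note simps = UP_ring_on_simps[OF R]
  have "prime_height (UP (ring_on R)) (extended_ideal (ring_on R) P) = 1"
    if P: "primeideal P (ring_on R)" "prime_height (ring_on R) P = 1" for P
  proof -
    have prime: "is_prime R P" using P(1) by (simp add: primeideal_ring_on[OF R])
    have P0: "P \<noteq> {0}" and P_min: "\<And>Q. is_prime R Q \<Longrightarrow> Q \<subset> P \<Longrightarrow> Q = {0}"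
      using P prime_height_eq_1_iff[OF dom P(1)]
      by (auto simp: ring_on_simps primeideal_ring_on[OF R])
    have "P \<subseteq> R" "0 \<in> P" using prime by (auto simp: is_prime_def is_ideal_def)
    then have "coeff ` poly_set P \<subseteq> coeff ` poly_set R" by (intro image_mono poly_set_mono)
    then have ext: "extended_ideal (ring_on R) P = coeff ` poly_set P"
      unfolding extended_ideal_def simps(1)
      by (auto simp: UP_def up_ring_on[OF subring_zero[OF R]] poly_set_def)
    have extprime: "primeideal (coeff ` poly_set P) (UP (ring_on R))"
      unfolding primeideal_UP_ring_on[OF R] using is_prime_poly_set[OF R prime] by blast
    obtain r where r: "r \<in> P" "r \<noteq> 0" using P0 \<open>0 \<in> P\<close> by auto
    then have "[:r:] \<in> poly_set P" "[:r:] \<noteq> 0"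
      using \<open>0 \<in> P\<close> by (auto simp: pCons_in_poly_set zero_in_poly_set)
    then have "coeff ` poly_set P \<noteq> {coeff 0}"
      by (metis coeff_inject imageI singletonD)
    moreover have "Q = {coeff 0}"
      if Q: "primeideal Q (UP (ring_on R))" "Q \<subset> coeff ` poly_set P" for Q
    proof -
      obtain N where N: "Q = coeff ` N" "is_prime (poly_set R) N"
        using Q(1) unfolding primeideal_UP_ring_on[OF R] by blast
      have "N \<subset> poly_set P" using Q(2) N(1) by (auto simp: coeff_inject psubset_eq image_iff)
      then have "N = {0}" using no_prime_below_extension[OF prime P0 P_min N(2)] by blast
      then show ?thesis using N by simp
    qed
    ultimately show ?thesis
      unfolding ext prime_height_eq_1_iff[OF UP_domain extprime] simps(5) by blast
  qed
  then show ?thesis unfolding S_domain_def eq using dom by blast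
qed

end
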